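(* Let $\mathcal{H}$ be a nonzero complex Hilbert space. Let $\Phi, f\in OM_{1}$ be non-constant, and let $\sigma$ be the operator mean whose representing function is $\Phi$. Suppose $\Phi'(1)=w\in(0,1)$. Then for all $A,B\in B(\mathcal{H})_{sa}$ the following are equivalent: (1) $(1-w)A\leq wB$; (2) $f(\lambda A+I)\,\sigma\, f(-\lambda B+I)\leq I$ for all sufficiently small $\lambda\geq 0$.
   Context: $B(\mathcal{H})$ is the algebra of bounded linear operators on $\mathcal{H}$, $I$ is the identity, $B(\mathcal{H})_{sa}$ is the set of self-adjoint operators, and $B(\mathcal{H})_{+}$ is the set of positive definite (positive and invertible) operators. For self-adjoint $A,B$, $A\leq B$ means $B-A$ is positive semi-definite. A real-valued function $f$ on an interval $J$ is operator monotone if $A\leq B$ implies $f(A)\leq f(B)$ for all $A,B\in B(\mathcal{H})_{sa}$ with spectra in $J$ (for every complex Hilbert space $\mathcal{H}$). $OM_{1}$ is the set of operator monotone functions $f:(0,\infty)\to(0,\infty)$ with $f(1)=1$. The operator mean $\sigma$ with representing function $\Phi\in OM_1$ is the binary operation on $B(\mathcal{H})_{+}$ given by $A\sigma B=A^{1/2}\Phi(A^{-1/2}BA^{-1/2})A^{1/2}$. Functions of self-adjoint operators are given by the functional calculus. "For all sufficiently small $\lambda\ge 0$" means: there is $\lambda_0>0$ such that for all $\lambda\in[0,\lambda_0]$ the operators $\lambda A+I$ and $-\lambda B+I$ have spectra in $(0,\infty)$ and the inequality holds. *)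

theory Defs
  imports "HOL-Analysis.Analysis" "HOL-Computational_Algebra.Polynomial" "HOL-Library.FuncSet"
begin

(* Complex Hilbert spaces occur in two forms. The ambient space is a type of class
   chilbert_space. Operator monotonicity quantifies over all complex Hilbert spaces, which
   cannot be done over types; there a space is a record of operations on a carrier set.
   All operator-theoretic notions are defined once, for records; a type of class
   chilbert_space is turned into a record by univ_hspace below. *)

record 'a hspace =
  hcarrier :: "'a set"
  hzero :: 'a
  hadd :: "'a \<Rightarrow> 'a \<Rightarrow> 'a"
  hscale :: "complex \<Rightarrow> 'a \<Rightarrow> 'a"
  hinner :: "'a \<Rightarrow> 'a \<Rightarrow> complex"

definition hdiff :: "'a hspace \<Rightarrow> 'a \<Rightarrow> 'a \<Rightarrow> 'a"
  where "hdiff H x y = hadd H x (hscale H (- 1) y)"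

definition hnorm :: "'a hspace \<Rightarrow> 'a \<Rightarrow> real"
  where "hnorm H x = sqrt (Re (hinner H x x))"

(* The inner product is linear in its first argument. *)
locale complex_hilbert_space =
  fixes H :: "'a hspace"
  assumes zero_closed: "hzero H \<in> hcarrier H"
    and add_closed: "\<lbrakk>x \<in> hcarrier H; y \<in> hcarrier H\<rbrakk> \<Longrightarrow> hadd H x y \<in> hcarrier H"
    and scale_closed: "x \<in> hcarrier H \<Longrightarrow> hscale H c x \<in> hcarrier H"
    and add_assoc: "\<lbrakk>x \<in> hcarrier H; y \<in> hcarrier H; z \<in> hcarrier H\<rbrakk>
      \<Longrightarrow> hadd H (hadd H x y) z = hadd H x (hadd H y z)"
    and add_commute: "\<lbrakk>x \<in> hcarrier H; y \<in> hcarrier H\<rbrakk> \<Longrightarrow> hadd H x y = hadd H y x"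
    and add_zero: "x \<in> hcarrier H \<Longrightarrow> hadd H x (hzero H) = x"
    and add_inverse: "x \<in> hcarrier H \<Longrightarrow> hadd H x (hscale H (- 1) x) = hzero H"
    and scale_add_right: "\<lbrakk>x \<in> hcarrier H; y \<in> hcarrier H\<rbrakk>
      \<Longrightarrow> hscale H c (hadd H x y) = hadd H (hscale H c x) (hscale H c y)"
    and scale_add_left: "x \<in> hcarrier H
      \<Longrightarrow> hscale H (c + d) x = hadd H (hscale H c x) (hscale H d x)"
    and scale_scale: "x \<in> hcarrier H \<Longrightarrow> hscale H c (hscale H d x) = hscale H (c * d) x"
    and scale_one: "x \<in> hcarrier H \<Longrightarrow> hscale H 1 x = x"
    and inner_commute: "\<lbrakk>x \<in> hcarrier H; y \<in> hcarrier H\<rbrakk>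
      \<Longrightarrow> hinner H x y = cnj (hinner H y x)"
    and inner_add_left: "\<lbrakk>x \<in> hcarrier H; y \<in> hcarrier H; z \<in> hcarrier H\<rbrakk>
      \<Longrightarrow> hinner H (hadd H x y) z = hinner H x z + hinner H y z"
    and inner_scale_left: "\<lbrakk>x \<in> hcarrier H; y \<in> hcarrier H\<rbrakk>
      \<Longrightarrow> hinner H (hscale H c x) y = c * hinner H x y"
    and inner_nonneg: "x \<in> hcarrier H \<Longrightarrow> 0 \<le> Re (hinner H x x)"
    and inner_definite: "\<lbrakk>x \<in> hcarrier H; hinner H x x = 0\<rbrakk> \<Longrightarrow> x = hzero H"
    and complete: "\<lbrakk>range X \<subseteq> hcarrier H;
        \<forall>e>0. \<exists>N. \<forall>m\<ge>N. \<forall>n\<ge>N. hnorm H (hdiff H (X m) (X n)) < e\<rbrakk>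
      \<Longrightarrow> \<exists>l\<in>hcarrier H. (\<lambda>n. hnorm H (hdiff H (X n) l)) \<longlonglongrightarrow> 0"

class chilbert_space = real_inner + complete_space +
  fixes scaleC :: "complex \<Rightarrow> 'a \<Rightarrow> 'a"  (infixr \<open>*\<^sub>C\<close> 75)
    and cinner :: "'a \<Rightarrow> 'a \<Rightarrow> complex"
  assumes scaleR_scaleC: "r *\<^sub>R x = complex_of_real r *\<^sub>C x"
    and scaleC_add_right: "c *\<^sub>C (x + y) = c *\<^sub>C x + c *\<^sub>C y"
    and scaleC_add_left: "(c + d) *\<^sub>C x = c *\<^sub>C x + d *\<^sub>C x"
    and scaleC_scaleC: "c *\<^sub>C (d *\<^sub>C x) = (c * d) *\<^sub>C x"
    and cinner_commute: "cinner x y = cnj (cinner y x)"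
    and cinner_add_left: "cinner (x + y) z = cinner x z + cinner y z"
    and cinner_scaleC_left: "cinner (c *\<^sub>C x) y = c * cinner x y"
    and inner_eq_Re_cinner: "inner x y = Re (cinner x y)"

instantiation complex :: chilbert_space
begin
definition scaleC_complex :: "complex \<Rightarrow> complex \<Rightarrow> complex"
  where "scaleC_complex c x = c * x"
definition cinner_complex :: "complex \<Rightarrow> complex \<Rightarrow> complex"
  where "cinner_complex x y = x * cnj y"
instance
  by standard (auto simp: scaleC_complex_def cinner_complex_def inner_complex_def
      scaleR_conv_of_real algebra_simps)
end

definition univ_hspace :: "'a::chilbert_space hspace"
  where "univ_hspace = \<lparr>hcarrier = UNIV, hzero = 0, hadd = (+), hscale = scaleC, hinner = cinner\<rparr>"

lemma scaleC_one: "1 *\<^sub>C x = (x :: 'a::chilbert_space)"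
  using scaleR_scaleC[of 1 x] by simp

lemma scaleC_minus_one: "(- 1) *\<^sub>C x = - (x :: 'a::chilbert_space)"
  using scaleR_scaleC[of "- 1" x] by simp

lemma hnorm_univ_hspace: "hnorm univ_hspace x = norm (x :: 'a::chilbert_space)"
  by (simp add: hnorm_def univ_hspace_def norm_eq_sqrt_inner inner_eq_Re_cinner)

lemma hdiff_univ_hspace: "hdiff univ_hspace x y = x - (y :: 'a::chilbert_space)"
  by (simp add: hdiff_def univ_hspace_def scaleC_minus_one)

lemma complex_hilbert_space_univ_hspace:
  "complex_hilbert_space (univ_hspace :: 'a::chilbert_space hspace)"
proof (unfold_locales, unfold hnorm_univ_hspace hdiff_univ_hspace)
  fix X :: "nat \<Rightarrow> 'a"
  assume "\<forall>e>0. \<exists>N. \<forall>m\<ge>N. \<forall>n\<ge>N. norm (X m - X n) < e"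
  then have "Cauchy X"
    by (simp add: Cauchy_def dist_norm)
  then obtain l where "X \<longlonglongrightarrow> l"
    using Cauchy_convergent_iff convergent_def by blast
  then show "\<exists>l\<in>hcarrier univ_hspace. (\<lambda>n. norm (X n - l)) \<longlonglongrightarrow> 0"
    by (auto simp: univ_hspace_def LIM_zero tendsto_norm_zero intro!: exI[of _ l])
next
  fix x :: 'a
  assume "hinner univ_hspace x x = 0"
  then show "x = hzero univ_hspace"
    using inner_eq_zero_iff[of x] by (simp add: univ_hspace_def inner_eq_Re_cinner)
next
  fix x y :: 'a
  show "hinner univ_hspace x y = cnj (hinner univ_hspace y x)"
    unfolding univ_hspace_def using cinner_commute[of x y] by simp
next
  fix x :: 'a
  show "0 \<le> Re (hinner univ_hspace x x)"
    using inner_ge_zero[of x] by (simp add: univ_hspace_def inner_eq_Re_cinner)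
qed (simp_all add: univ_hspace_def scaleC_add_right scaleC_add_left scaleC_scaleC scaleC_one
    scaleC_minus_one cinner_add_left cinner_scaleC_left add.assoc add.commute)

(* Operators are extensional functions (fixed value off the carrier), so that equality of
   operators is equality in HOL. *)
definition bounded_ops :: "'a hspace \<Rightarrow> ('a \<Rightarrow> 'a) set"
  where "bounded_ops H = {T \<in> hcarrier H \<rightarrow>\<^sub>E hcarrier H.
    (\<forall>x\<in>hcarrier H. \<forall>y\<in>hcarrier H. T (hadd H x y) = hadd H (T x) (T y)) \<and>
    (\<forall>c. \<forall>x\<in>hcarrier H. T (hscale H c x) = hscale H c (T x)) \<and>
    (\<exists>K. \<forall>x\<in>hcarrier H. hnorm H (T x) \<le> K * hnorm H x)}"

definition op_id :: "'a hspace \<Rightarrow> 'a \<Rightarrow> 'a"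
  where "op_id H = (\<lambda>x\<in>hcarrier H. x)"

definition op_zero :: "'a hspace \<Rightarrow> 'a \<Rightarrow> 'a"
  where "op_zero H = (\<lambda>x\<in>hcarrier H. hzero H)"

definition op_add :: "'a hspace \<Rightarrow> ('a \<Rightarrow> 'a) \<Rightarrow> ('a \<Rightarrow> 'a) \<Rightarrow> 'a \<Rightarrow> 'a"
  where "op_add H S T = (\<lambda>x\<in>hcarrier H. hadd H (S x) (T x))"

definition op_scale :: "'a hspace \<Rightarrow> complex \<Rightarrow> ('a \<Rightarrow> 'a) \<Rightarrow> 'a \<Rightarrow> 'a"
  where "op_scale H c T = (\<lambda>x\<in>hcarrier H. hscale H c (T x))"

definition op_diff :: "'a hspace \<Rightarrow> ('a \<Rightarrow> 'a) \<Rightarrow> ('a \<Rightarrow> 'a) \<Rightarrow> 'a \<Rightarrow> 'a"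
  where "op_diff H S T = op_add H S (op_scale H (- 1) T)"

abbreviation op_comp :: "'a hspace \<Rightarrow> ('a \<Rightarrow> 'a) \<Rightarrow> ('a \<Rightarrow> 'a) \<Rightarrow> 'a \<Rightarrow> 'a"
  where "op_comp H S T \<equiv> compose (hcarrier H) S T"

definition op_norm :: "'a hspace \<Rightarrow> ('a \<Rightarrow> 'a) \<Rightarrow> real"
  where "op_norm H T = (SUP x\<in>{x \<in> hcarrier H. hnorm H x \<le> 1}. hnorm H (T x))"

definition self_adjoint_ops :: "'a hspace \<Rightarrow> ('a \<Rightarrow> 'a) set"
  where "self_adjoint_ops H = {T \<in> bounded_ops H.
    \<forall>x\<in>hcarrier H. \<forall>y\<in>hcarrier H. hinner H (T x) y = hinner H x (T y)}"

definition pos_semidef :: "'a hspace \<Rightarrow> ('a \<Rightarrow> 'a) \<Rightarrow> bool"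
  where "pos_semidef H T \<longleftrightarrow> T \<in> self_adjoint_ops H \<and>
    (\<forall>x\<in>hcarrier H. 0 \<le> Re (hinner H (T x) x))"

definition op_le :: "'a hspace \<Rightarrow> ('a \<Rightarrow> 'a) \<Rightarrow> ('a \<Rightarrow> 'a) \<Rightarrow> bool"
  where "op_le H S T \<longleftrightarrow> pos_semidef H (op_diff H T S)"

definition op_invertible :: "'a hspace \<Rightarrow> ('a \<Rightarrow> 'a) \<Rightarrow> bool"
  where "op_invertible H T \<longleftrightarrow>
    (\<exists>S\<in>bounded_ops H. op_comp H S T = op_id H \<and> op_comp H T S = op_id H)"

definition op_spectrum :: "'a hspace \<Rightarrow> ('a \<Rightarrow> 'a) \<Rightarrow> complex set"
  where "op_spectrum H T = {z. \<not> op_invertible H (op_diff H T (op_scale H z (op_id H)))}"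

definition spectrum_in :: "'a hspace \<Rightarrow> ('a \<Rightarrow> 'a) \<Rightarrow> real set \<Rightarrow> bool"
  where "spectrum_in H T J \<longleftrightarrow> op_spectrum H T \<subseteq> complex_of_real ` J"

definition real_spectrum :: "'a hspace \<Rightarrow> ('a \<Rightarrow> 'a) \<Rightarrow> real set"
  where "real_spectrum H T = {t. complex_of_real t \<in> op_spectrum H T}"

definition poly_op :: "'a hspace \<Rightarrow> real poly \<Rightarrow> ('a \<Rightarrow> 'a) \<Rightarrow> 'a \<Rightarrow> 'a"
  where "poly_op H p T =
    fold_coeffs (\<lambda>a S. op_add H (op_scale H (complex_of_real a) (op_id H)) (op_comp H T S))
      p (op_zero H)"

(* Continuous functional calculus: f(T) is the norm limit of p_n(T) for all sequences of
   polynomials p_n converging to f uniformly on the spectrum. It is meaningful for self-adjoint T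
   and f continuous on the spectrum of T. *)
definition fun_calc :: "'a hspace \<Rightarrow> (real \<Rightarrow> real) \<Rightarrow> ('a \<Rightarrow> 'a) \<Rightarrow> 'a \<Rightarrow> 'a"
  where "fun_calc H f T = (THE S. S \<in> bounded_ops H \<and>
    (\<forall>p :: nat \<Rightarrow> real poly.
      uniform_limit (real_spectrum H T) (\<lambda>n. poly (p n)) f sequentially \<longrightarrow>
      (\<lambda>n. op_norm H (op_diff H (poly_op H (p n) T) S)) \<longlonglongrightarrow> 0))"

(* H ranges over all complex Hilbert spaces whose carrier is a subset of the type 'a. If 'a is
   itself a nonzero complex Hilbert space, it has at least continuum many elements, so that this
   includes, up to isomorphism, all separable complex Hilbert spaces, in addition to the
   space 'a itself.
   Continuity of f on J is not assumed: f(A) and f(B) are compared whenever they are defined,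
   that is, whenever f is continuous on both spectra (in particular whenever these are finite). *)
definition operator_monotone :: "'a itself \<Rightarrow> real set \<Rightarrow> (real \<Rightarrow> real) \<Rightarrow> bool"
  where "operator_monotone _ J f \<longleftrightarrow>
    (\<forall>H :: 'a hspace. complex_hilbert_space H \<longrightarrow>
      (\<forall>A\<in>self_adjoint_ops H. \<forall>B\<in>self_adjoint_ops H.
        spectrum_in H A J \<longrightarrow> spectrum_in H B J \<longrightarrow>
        continuous_on (real_spectrum H A) f \<longrightarrow> continuous_on (real_spectrum H B) f \<longrightarrow>
        op_le H A B \<longrightarrow> op_le H (fun_calc H f A) (fun_calc H f B)))"

(* Functions on the positive half-line are represented by total functions whose values at
   nonpositive arguments are irrelevant. *)
definition OM1 :: "'a itself \<Rightarrow> (real \<Rightarrow> real) set"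
  where "OM1 U = {f. (\<forall>x>0. 0 < f x) \<and> operator_monotone U {0<..} f \<and> f 1 = 1}"

definition op_mean ::
    "'a hspace \<Rightarrow> (real \<Rightarrow> real) \<Rightarrow> ('a \<Rightarrow> 'a) \<Rightarrow> ('a \<Rightarrow> 'a) \<Rightarrow> 'a \<Rightarrow> 'a"
  where "op_mean H \<Phi> A B =
    (let R = fun_calc H sqrt A; R' = fun_calc H (\<lambda>t. 1 / sqrt t) A
     in op_comp H R (op_comp H (fun_calc H \<Phi> (op_comp H R' (op_comp H B R'))) R))"

end

(* Transporting the operations of C^2 into the given space along an injection, operator
   monotonicity of f can be tested on 2x2 matrices. A matrix with eigenvalues a, b and diagonal
   entries M = t a + (1 - t) b and N = (1 - t) a + t b lies below diag(m, k), for some k, as soon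
   as m > M, and above some diag(m, k) with k > 0 as soon as m is less than the weighted harmonic
   mean ab/N. Comparing (1,1) entries, f is concave and continuous on the half-line, and the
   harmonic inequality at 1 + h, 1 - h excludes a kink at 1: for \<alpha> = f'(1),
   0 \<le> 1 + \<alpha> (x - 1) - f x \<le> C (x - 1)^2 near 1, the left inequality being global; moreover
   \<alpha> > 0 unless f is constant. The same holds for \<Phi>, with w in place of \<alpha>.

   For X = I + sA, Y = I - sB, P = f X, Q = f Y, the upper bounds and the functional calculus give
   \<langle>(P \<sigma> Q) x, x\<rangle> \<le> |x|^2 + \<alpha> s \<langle>((1 - w) A - w B) x, x\<rangle>, hence (1) implies (2). The quadratic
   lower bounds show that this is sharp up to O(s^2), hence (2) implies (1). *)
theory Submission
  imports Defs "HOL-Computational_Algebra.Fundamental_Theorem_Algebra"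
begin

section \<open>Operators on the ambient space\<close>

text \<open>Operator monotonicity is only given on spaces carried by subsets of one type. The space
  itself may be one-dimensional; its own operators are then scalars and carry no more than scalar
  monotonicity. So C^2 has to enter by cardinality, along an injection that need not be linear. A
  second obstacle is that \<open>f\<close> is not assumed continuous. Matrices have finite spectra,
  so the functional calculus makes sense for them at once; continuity on the half-line must be
  established before \<open>f\<close> is applied to I + sA, whose spectrum may be infinite.
  Differentiability of \<open>f\<close> at 1 is likewise a result. Third, \<open>fun_calc\<close> is
  a definite description, so its existence and its order and product rules have to be built up.
  Everything there rests on one criterion: a self-adjoint operator that is bounded below is
  invertible. Factoring a real polynomial into linear and quadratic factors then bounds p(T) by the
  supremum of |p| on the spectrum. Affine bounds for a scalar function translate exactly into
  quadratic forms. This is why tangent lines at 1, with a quadratic error, are the form in which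
  scalar information is collected.\<close>

lemma univ_hspace_simps [simp]:
  "hcarrier univ_hspace = UNIV" "hzero univ_hspace = 0" "hadd univ_hspace = (+)"
  "hscale univ_hspace = scaleC" "hinner univ_hspace = cinner"
  by (simp_all add: univ_hspace_def)

lemma op_univ_hspace [simp]:
  fixes S T :: "'a::chilbert_space \<Rightarrow> 'a"
  shows "op_id univ_hspace = (\<lambda>x::'a. x)"
    and "op_zero univ_hspace = (\<lambda>x::'a. 0)"
    and "op_add univ_hspace S T = (\<lambda>x. S x + T x)"
    and "op_scale univ_hspace c T = (\<lambda>x. c *\<^sub>C T x)"
    and "op_diff univ_hspace S T = (\<lambda>x. S x - T x)"
    and "compose UNIV S T = (\<lambda>x. S (T x))"
  by (simp_all add: op_id_def op_zero_def op_add_def op_scale_def op_diff_def compose_def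
      scaleC_minus_one fun_eq_iff)

declare hnorm_univ_hspace [simp]

lemma scaleC_of_real [simp]: "complex_of_real r *\<^sub>C x = r *\<^sub>R (x :: 'a::chilbert_space)"
  by (simp add: scaleR_scaleC)

lemma scaleC_scaleR: "c *\<^sub>C (r *\<^sub>R x) = r *\<^sub>R (c *\<^sub>C (x :: 'a::chilbert_space))"
  by (simp only: scaleR_scaleC scaleC_scaleC mult.commute)

lemma cinner_scaleC_right: "cinner x (c *\<^sub>C y) = cnj c * cinner x (y :: 'a::chilbert_space)"
  by (metis cinner_commute cinner_scaleC_left complex_cnj_mult)

lemma inner_scaleC_left: "inner (c *\<^sub>C x) y = inner x (cnj c *\<^sub>C (y :: 'a::chilbert_space))"
  by (simp add: inner_eq_Re_cinner cinner_scaleC_left cinner_scaleC_right)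

lemma norm_scaleC [simp]: "norm (c *\<^sub>C x) = cmod c * norm (x :: 'a::chilbert_space)"
proof -
  have "inner (c *\<^sub>C x) (c *\<^sub>C x) = inner x ((cnj c * c) *\<^sub>C x)"
    by (simp add: inner_scaleC_left scaleC_scaleC)
  also have "cnj c * c = complex_of_real ((cmod c)\<^sup>2)"
    using complex_norm_square[of c] by (simp add: mult.commute)
  finally have "inner (c *\<^sub>C x) (c *\<^sub>C x) = (cmod c)\<^sup>2 * inner x x"
    by (simp only: scaleC_of_real inner_scaleR_right)
  then show ?thesis
    by (simp add: norm_eq_sqrt_inner real_sqrt_mult)
qed

lemma scaleC_zero_right [simp]: "c *\<^sub>C 0 = (0 :: 'a::chilbert_space)"
  by (metis norm_eq_zero norm_scaleC mult_zero_right)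

lemma scaleC_minus_right: "c *\<^sub>C (- x) = - (c *\<^sub>C (x :: 'a::chilbert_space))"
  by (metis add.right_inverse add_eq_0_iff scaleC_add_right scaleC_zero_right)

lemma scaleC_diff_right: "c *\<^sub>C (x - y) = c *\<^sub>C x - c *\<^sub>C (y :: 'a::chilbert_space)"
  by (metis scaleC_add_right scaleC_minus_right diff_conv_add_uminus)

text \<open>The imaginary part is Im <x, y> = Re <x, iy>. Symmetry of a complex-linear operator can
  therefore be checked in the real inner product alone.\<close>

lemma cinner_eq_inner:
  fixes x y :: "'a::chilbert_space"
  shows "cinner x y = Complex (inner x y) (inner x (\<i> *\<^sub>C y))"
  by (simp add: complex_eq_iff inner_eq_Re_cinner cinner_scaleC_right)

lemma bounded_ops_iff:
  fixes T :: "'a::chilbert_space \<Rightarrow> 'a"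
  shows "T \<in> bounded_ops univ_hspace \<longleftrightarrow>
    bounded_linear T \<and> (\<forall>c x. T (c *\<^sub>C x) = c *\<^sub>C T x)"
proof
  assume T: "T \<in> bounded_ops univ_hspace"
  then have lin: "T (c *\<^sub>C x) = c *\<^sub>C T x" "T (x + y) = T x + T y" for c x y
    by (auto simp: bounded_ops_def)
  obtain K where "\<And>x. norm (T x) \<le> K * norm x"
    using T by (auto simp: bounded_ops_def)
  then have "bounded_linear T"
    using lin(1)[of "complex_of_real _"]
    by (intro bounded_linear_intro[of T K]) (auto simp: lin mult.commute)
  then show "bounded_linear T \<and> (\<forall>c x. T (c *\<^sub>C x) = c *\<^sub>C T x)"
    using lin by blast
next
  assume T: "bounded_linear T \<and> (\<forall>c x. T (c *\<^sub>C x) = c *\<^sub>C T x)"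
  then obtain K where "\<And>x. norm (T x) \<le> norm x * K"
    using bounded_linear.bounded by blast
  with T show "T \<in> bounded_ops univ_hspace"
    by (auto simp: bounded_ops_def linear_add bounded_linear.linear mult.commute[of "norm _"] PiE_UNIV_domain)
qed

lemma self_adjoint_ops_iff:
  fixes T :: "'a::chilbert_space \<Rightarrow> 'a"
  shows "T \<in> self_adjoint_ops univ_hspace \<longleftrightarrow> bounded_linear T \<and>
    (\<forall>c x. T (c *\<^sub>C x) = c *\<^sub>C T x) \<and> (\<forall>x y. inner (T x) y = inner x (T y))"
proof -
  have "cinner (T x) y = cinner x (T y)"
    if "\<And>c x. T (c *\<^sub>C x) = c *\<^sub>C T x" "\<And>x y. inner (T x) y = inner x (T y)" for x y
    by (simp add: cinner_eq_inner flip: that)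
  then show ?thesis
    by (auto simp: self_adjoint_ops_def bounded_ops_iff inner_eq_Re_cinner)
qed

lemma self_adjointI:
  fixes T :: "'a::chilbert_space \<Rightarrow> 'a"
  assumes "bounded_linear T" "\<And>c x. T (c *\<^sub>C x) = c *\<^sub>C T x" "\<And>x y. inner (T x) y = inner x (T y)"
  shows "T \<in> self_adjoint_ops univ_hspace"
  using assms by (simp add: self_adjoint_ops_iff)

lemma self_adjointD:
  fixes T :: "'a::chilbert_space \<Rightarrow> 'a"
  assumes "T \<in> self_adjoint_ops univ_hspace"
  shows "bounded_linear T" "T (c *\<^sub>C x) = c *\<^sub>C T x" "inner (T x) y = inner x (T y)"
    "T (x + y) = T x + T y" "T (x - y) = T x - T y" "T (r *\<^sub>R x) = r *\<^sub>R T x" "T 0 = 0"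
proof -
  show "bounded_linear T" and "T (c *\<^sub>C x) = c *\<^sub>C T x" and "inner (T x) y = inner x (T y)"
    using assms by (auto simp: self_adjoint_ops_iff)
  then interpret bounded_linear T by simp
  show "T (x + y) = T x + T y" "T (x - y) = T x - T y" "T (r *\<^sub>R x) = r *\<^sub>R T x" "T 0 = 0"
    by (simp_all add: add diff scaleR zero)
qed

lemma self_adjoint_affine:
  fixes T :: "'a::chilbert_space \<Rightarrow> 'a"
  assumes "T \<in> self_adjoint_ops univ_hspace"
  shows "(\<lambda>x. a *\<^sub>R x + b *\<^sub>R T x) \<in> self_adjoint_ops univ_hspace"
proof (rule self_adjointI)
  show "bounded_linear (\<lambda>x. a *\<^sub>R x + b *\<^sub>R T x)"
    by (intro bounded_linear_add bounded_linear_const_scaleR bounded_linear_ident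
        self_adjointD(1)[OF assms])
qed (simp_all add: self_adjointD[OF assms] inner_add_left inner_add_right scaleC_add_right
    scaleC_scaleR)

lemma pos_semidef_iff:
  fixes T :: "'a::chilbert_space \<Rightarrow> 'a"
  shows "pos_semidef univ_hspace T \<longleftrightarrow>
    T \<in> self_adjoint_ops univ_hspace \<and> (\<forall>x. 0 \<le> inner (T x) x)"
  by (simp add: pos_semidef_def inner_eq_Re_cinner)

lemma self_adjoint_diff:
  fixes S T :: "'a::chilbert_space \<Rightarrow> 'a"
  assumes "S \<in> self_adjoint_ops univ_hspace" "T \<in> self_adjoint_ops univ_hspace"
  shows "(\<lambda>x. S x - T x) \<in> self_adjoint_ops univ_hspace"
  by (rule self_adjointI)
    (simp_all add: bounded_linear_sub self_adjointD[OF assms(1)] self_adjointD[OF assms(2)]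
      inner_diff_left inner_diff_right scaleC_diff_right)

text \<open>Reduces the order to quadratic forms, the shape in which operator inequalities are
  handled from here on.\<close>

lemma op_le_iff:
  fixes S T :: "'a::chilbert_space \<Rightarrow> 'a"
  assumes "S \<in> self_adjoint_ops univ_hspace" "T \<in> self_adjoint_ops univ_hspace"
  shows "op_le univ_hspace S T \<longleftrightarrow> (\<forall>x. inner (S x) x \<le> inner (T x) x)"
  using self_adjoint_diff[OF assms(2,1)] by (simp add: op_le_def pos_semidef_iff inner_diff_left)

section \<open>Spectrum\<close>

lemma op_invertible_bounded_below:
  fixes T :: "'a::chilbert_space \<Rightarrow> 'a"
  assumes "op_invertible univ_hspace T"
  obtains c where "c > 0" "\<And>x. c * norm x \<le> norm (T x)"
proof -
  obtain S where S: "S \<in> bounded_ops univ_hspace" "\<And>x. S (T x) = x"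
    using assms by (auto simp: op_invertible_def fun_eq_iff)
  then obtain K where K: "K > 0" "\<And>x. norm (S x) \<le> norm x * K"
    using bounded_linear.pos_bounded[of S] by (auto simp: bounded_ops_iff)
  have "norm x \<le> norm (T x) * K" for x
    using K(2)[of "T x"] by (simp add: S)
  with K(1) show thesis
    by (intro that[of "1 / K"]) (simp_all add: field_simps)
qed

(* With T self-adjoint and \<eta> = 1/K^2, the map x \<mapsto> x - \<eta> (T (T x) - y) is a contraction. *)
lemma self_adjoint_bounded_below_surj:
  fixes T :: "'a::chilbert_space \<Rightarrow> 'a"
  assumes T: "T \<in> self_adjoint_ops univ_hspace"
    and c: "c > 0" "\<And>x. c * norm x \<le> norm (T x)"
  shows "surj T"
proof -
  obtain K where K: "K > 0" "\<And>x. norm (T x) \<le> norm x * K"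
    using bounded_linear.pos_bounded[OF self_adjointD(1)[OF T]] by blast
  define \<eta> where "\<eta> = 1 / K\<^sup>2"
  \<comment> \<open>The \<open>max 0\<close> matters only on the zero space: as soon as there is a
    nonzero vector, c |x| \<le> |Tx| \<le> K |x| forces \<open>c\<close> \<le>
    \<open>K\<close>.\<close>
  define L where "L = sqrt (max 0 (1 - \<eta> * c\<^sup>2))"
  have \<eta>: "\<eta> > 0" "\<eta> * K\<^sup>2 = 1"
    using K by (simp_all add: \<eta>_def)
  have contr: "norm (x - \<eta> *\<^sub>R T (T x)) \<le> L * norm x" for x
  proof -
    have "(norm (T (T x)))\<^sup>2 \<le> (norm (T x) * K)\<^sup>2"
      using K by (intro power_mono) auto
    then have 1: "\<eta>\<^sup>2 * (norm (T (T x)))\<^sup>2 \<le> \<eta> * (norm (T x))\<^sup>2 * (\<eta> * K\<^sup>2)"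
      using \<eta>(1) by (simp add: power2_eq_square mult_ac)
    have "(c * norm x)\<^sup>2 \<le> (norm (T x))\<^sup>2"
      using c by (intro power_mono) auto
    then have 2: "\<eta> * (c\<^sup>2 * (norm x)\<^sup>2) \<le> \<eta> * (norm (T x))\<^sup>2"
      using \<eta>(1) by (simp add: power_mult_distrib)
    have "(norm (x - \<eta> *\<^sub>R T (T x)))\<^sup>2 =
        (norm x)\<^sup>2 - 2 * \<eta> * (norm (T x))\<^sup>2 + \<eta>\<^sup>2 * (norm (T (T x)))\<^sup>2"
      by (simp add: power2_norm_eq_inner inner_diff_left inner_diff_right inner_commute
          self_adjointD(3)[OF T]) (simp add: power2_eq_square)
    also have "\<dots> \<le> (norm x)\<^sup>2 - \<eta> * (norm (T x))\<^sup>2"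
      using 1 \<eta> by (simp add: algebra_simps)
    also have "\<dots> \<le> (1 - \<eta> * c\<^sup>2) * (norm x)\<^sup>2"
      using 2 by (simp add: algebra_simps)
    also have "\<dots> \<le> max 0 (1 - \<eta> * c\<^sup>2) * (norm x)\<^sup>2"
      by (intro mult_right_mono) auto
    also have "\<dots> = (L * norm x)\<^sup>2"
      by (simp add: L_def power_mult_distrib)
    finally show ?thesis
      by (rule power2_le_imp_le) (simp add: L_def)
  qed
  have "\<exists>x. T x = y" for y
  proof -
    let ?g = "\<lambda>x. x - \<eta> *\<^sub>R (T (T x) - y)"
    have "dist (?g x) (?g z) \<le> L * dist x z" for x z
    proof -
      have "?g x - ?g z = (x - z) - \<eta> *\<^sub>R T (T (x - z))"
        by (simp add: self_adjointD[OF T] algebra_simps)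
      then show ?thesis
        using contr[of "x - z"] unfolding dist_norm by (simp only:)
    qed
    moreover have "0 \<le> L" "L < 1"
      using \<eta> c by (auto simp: L_def)
    ultimately have "\<exists>!x. ?g x = x"
      using banach_fix_type[of L ?g] by blast
    then obtain x where "?g x = x"
      by blast
    then have "T (T x) = y"
      using \<eta> by (simp add: algebra_simps)
    then show ?thesis
      by blast
  qed
  then show ?thesis
    by (metis surjI)
qed

text \<open>The lower bound gives injectivity and the norm 1/c for the inverse; surjectivity is the
  contraction argument above. Statements about the spectrum thereby become norm estimates.\<close>

lemma self_adjoint_invertibleI:
  fixes T :: "'a::chilbert_space \<Rightarrow> 'a"
  assumes T: "T \<in> self_adjoint_ops univ_hspace"
    and c: "c > 0" "\<And>x. c * norm x \<le> norm (T x)"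
  shows "op_invertible univ_hspace T"
proof -
  have "x = y" if "T x = T y" for x y
    using c(2)[of "x - y"] c(1) that by (simp add: self_adjointD[OF T] mult_le_0_iff)
  then have "inj T"
    by (auto simp: inj_on_def)
  have surj: "surj T"
    by (rule self_adjoint_bounded_below_surj[OF assms])
  have inv: "T (inv T x) = x" "inv T (T x) = x" for x
    using \<open>inj T\<close> surj by (simp_all add: surj_f_inv_f)
  have lin: "inv T (x + y) = inv T x + inv T y" "inv T (c *\<^sub>C x) = c *\<^sub>C inv T x" for x y c
    by (rule injD[OF \<open>inj T\<close>]; simp add: inv self_adjointD[OF T])+
  have "norm (inv T x) \<le> (1 / c) * norm x" for x
    using c(2)[of "inv T x"] c(1) by (simp add: inv field_simps)
  then have "inv T \<in> bounded_ops univ_hspace"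
    unfolding bounded_ops_def using lin by (auto intro: exI[of _ "1 / c"])
  then show ?thesis
    unfolding op_invertible_def by (intro bexI[of _ "inv T"]) (simp_all add: inv)
qed

lemma real_spectrum_iff:
  fixes T :: "'a::chilbert_space \<Rightarrow> 'a"
  shows "t \<in> real_spectrum univ_hspace T \<longleftrightarrow> \<not> op_invertible univ_hspace (\<lambda>x. T x - t *\<^sub>R x)"
  by (simp add: real_spectrum_def op_spectrum_def)

lemma not_in_real_spectrumI:
  fixes T :: "'a::chilbert_space \<Rightarrow> 'a"
  assumes T: "T \<in> self_adjoint_ops univ_hspace"
    and c: "c > 0" "\<And>x. c * norm x \<le> norm (T x - t *\<^sub>R x)"
  shows "t \<notin> real_spectrum univ_hspace T"
proof -
  have "(\<lambda>x. T x - t *\<^sub>R x) \<in> self_adjoint_ops univ_hspace"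
    using self_adjoint_affine[OF T, of "- t" 1] by simp
  then show ?thesis
    using c by (auto simp: real_spectrum_iff intro: self_adjoint_invertibleI)
qed

lemma bounded_below_off_real_spectrum:
  fixes T :: "'a::chilbert_space \<Rightarrow> 'a"
  assumes "t \<notin> real_spectrum univ_hspace T"
  obtains c where "c > 0" "\<And>x. c * norm x \<le> norm (T x - t *\<^sub>R x)"
  using assms op_invertible_bounded_below by (auto simp: real_spectrum_iff)

text \<open>Cauchy-Schwarz. The absolute value lets one lemma serve T - t both for t below and for t
  above the values of the form.\<close>

lemma form_lower_imp_bounded_below:
  fixes T :: "'a::real_inner \<Rightarrow> 'a"
  assumes "m * (norm x)\<^sup>2 \<le> \<bar>inner (T x) x\<bar>"
  shows "m * norm x \<le> norm (T x)"
proof (cases "x = 0")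
  case False
  have "m * norm x * norm x \<le> norm (T x) * norm x"
    using assms Cauchy_Schwarz_ineq2[of "T x" x] by (simp add: power2_eq_square mult.assoc)
  with False show ?thesis
    by simp
qed simp

lemma real_spectrum_bounds:
  fixes T :: "'a::chilbert_space \<Rightarrow> 'a"
  assumes T: "T \<in> self_adjoint_ops univ_hspace"
    and m: "\<And>x. m * (norm x)\<^sup>2 \<le> inner (T x) x"
    and M: "\<And>x. inner (T x) x \<le> M * (norm x)\<^sup>2"
  shows "real_spectrum univ_hspace T \<subseteq> {m..M}"
proof
  fix t assume t: "t \<in> real_spectrum univ_hspace T"
  have eq: "inner (T x - t *\<^sub>R x) x = inner (T x) x - t * (norm x)\<^sup>2" for x
    by (simp add: inner_diff_left power2_norm_eq_inner)
  note power2_norm_eq_inner[symmetric, simp]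
  have "\<not> t < m"
  proof
    assume "t < m"
    moreover have "(m - t) * norm x \<le> norm (T x - t *\<^sub>R x)" for x
      using m[of x] by (intro form_lower_imp_bounded_below) (simp add: eq algebra_simps)
    ultimately show False
      using not_in_real_spectrumI[OF T, of "m - t" t] t by simp
  qed
  moreover have "\<not> M < t"
  proof
    assume "M < t"
    moreover have "(t - M) * norm x \<le> norm (T x - t *\<^sub>R x)" for x
      using M[of x] by (intro form_lower_imp_bounded_below) (simp add: eq algebra_simps)
    ultimately show False
      using not_in_real_spectrumI[OF T, of "t - M" t] t by simp
  qed
  ultimately show "t \<in> {m..M}"
    by simp
qed

lemma self_adjoint_form_bound:
  fixes T :: "'a::chilbert_space \<Rightarrow> 'a"
  assumes "T \<in> self_adjoint_ops univ_hspace"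
  obtains K where "K > 0" "\<And>x. \<bar>inner (T x) x\<bar> \<le> K * (norm x)\<^sup>2"
proof -
  obtain K where K: "K > 0" "\<And>x. norm (T x) \<le> norm x * K"
    using bounded_linear.pos_bounded[OF self_adjointD(1)[OF assms]] by blast
  have "\<bar>inner (T x) x\<bar> \<le> K * (norm x)\<^sup>2" for x
  proof -
    have "\<bar>inner (T x) x\<bar> \<le> norm (T x) * norm x"
      by (rule Cauchy_Schwarz_ineq2)
    also have "\<dots> \<le> norm x * K * norm x"
      using K(2) by (intro mult_right_mono) auto
    finally show ?thesis
      by (simp add: power2_eq_square mult_ac)
  qed
  with K(1) show thesis
    by (rule that)
qed

text \<open>Closedness: a lower bound \<open>c\<close> for T - t persists as c/2 for T - r when |r -
  t| < c/2. Compactness is what the Weierstrass approximation needs.\<close>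

lemma compact_real_spectrum:
  fixes T :: "'a::chilbert_space \<Rightarrow> 'a"
  assumes T: "T \<in> self_adjoint_ops univ_hspace"
  shows "compact (real_spectrum univ_hspace T)"
proof -
  obtain K where K: "\<And>x. \<bar>inner (T x) x\<bar> \<le> K * (norm x)\<^sup>2"
    using self_adjoint_form_bound[OF T] by blast
  have "real_spectrum univ_hspace T \<subseteq> {- K..K}"
  proof (rule real_spectrum_bounds[OF T])
    fix x
    show "- K * (norm x)\<^sup>2 \<le> inner (T x) x" "inner (T x) x \<le> K * (norm x)\<^sup>2"
      using K[of x] by auto
  qed
  then have "bounded (real_spectrum univ_hspace T)"
    using bounded_closed_interval bounded_subset by blast
  moreover have "open (- real_spectrum univ_hspace T)"
  proof (rule openI)
    fix t assume "t \<in> - real_spectrum univ_hspace T"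
    then obtain c where c: "c > 0" "\<And>x. c * norm x \<le> norm (T x - t *\<^sub>R x)"
      using bounded_below_off_real_spectrum by blast
    have "ball t (c / 2) \<subseteq> - real_spectrum univ_hspace T"
    proof
      fix r assume r: "r \<in> ball t (c / 2)"
      have "c / 2 * norm x \<le> norm (T x - r *\<^sub>R x)" for x
      proof -
        have tri: "norm (T x - t *\<^sub>R x) \<le> norm (T x - r *\<^sub>R x) + norm ((r - t) *\<^sub>R x)"
          using norm_triangle_ineq[of "T x - r *\<^sub>R x" "(r - t) *\<^sub>R x"] by (simp add: algebra_simps)
        have "\<bar>r - t\<bar> * norm x \<le> c / 2 * norm x"
          using r by (intro mult_right_mono) (auto simp: dist_real_def abs_minus_commute)
        then have "norm ((r - t) *\<^sub>R x) \<le> c / 2 * norm x"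
          by simp
        then show ?thesis
          using tri c(2)[of x] by (simp add: field_simps)
      qed
      then show "r \<in> - real_spectrum univ_hspace T"
        using not_in_real_spectrumI[OF T, of "c / 2" r] c(1) by auto
    qed
    then show "\<exists>e>0. ball t e \<subseteq> - real_spectrum univ_hspace T"
      using c(1) by (intro exI[of _ "c / 2"]) auto
  qed
  ultimately show ?thesis
    by (simp add: compact_eq_bounded_closed closed_def)
qed

text \<open>\<open>spectrum_in\<close> speaks of the complex spectrum, so nonreal \<open>z\<close>
  must be excluded as well. T - z is not self-adjoint then; the invertibility criterion is applied
  to its product with the adjoint.\<close>

lemma spectrum_in_positiveI:
  fixes T :: "'a::chilbert_space \<Rightarrow> 'a"
  assumes T: "T \<in> self_adjoint_ops univ_hspace"
    and m: "m > 0" "\<And>x. m * (norm x)\<^sup>2 \<le> inner (T x) x"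
  shows "spectrum_in univ_hspace T {0<..}"
proof -
  have "z \<in> complex_of_real ` {0<..}" if z: "z \<in> op_spectrum univ_hspace T" for z
  proof (cases "Im z = 0")
    case True
    then have zr: "z = complex_of_real (Re z)"
      by (simp add: complex_eq_iff)
    obtain K where K: "\<And>x. \<bar>inner (T x) x\<bar> \<le> K * (norm x)\<^sup>2"
      using self_adjoint_form_bound[OF T] by blast
    have "Re z \<in> real_spectrum univ_hspace T"
      using z zr by (simp add: real_spectrum_def)
    then have "Re z \<ge> m"
      using real_spectrum_bounds[OF T m(2), of K] K by (fastforce simp: abs_le_iff)
    with m(1) zr show ?thesis
      by (metis greaterThan_iff imageI less_le_trans)
  next
    case False
    (* S* S = (T - Re z)^2 + (Im z)^2 for S = T - z *)
    define S where "S = (\<lambda>x. T x - z *\<^sub>C x)"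
    define S' where "S' = (\<lambda>x. T x - cnj z *\<^sub>C x)"
    define Q where "Q = (\<lambda>x. S' (S x))"
    have SS': "S (S' x) = Q x" for x
      by (simp add: Q_def S_def S'_def self_adjointD[OF T] scaleC_diff_right scaleC_scaleC
          algebra_simps)
    have blS: "bounded_linear (\<lambda>x. T x - c *\<^sub>C x)" for c
      by (intro bounded_linear_sub self_adjointD(1)[OF T]
          bounded_linear_intro[of "scaleC c" "cmod c"])
        (simp_all add: scaleC_add_right scaleR_scaleC scaleC_scaleC mult.commute del: scaleC_of_real)
    have adj: "inner (S x) y = inner x (S' y)" for x y
      by (simp add: S_def S'_def inner_diff_left inner_diff_right self_adjointD(3)[OF T]
          inner_scaleC_left)
    have Q: "Q \<in> self_adjoint_ops univ_hspace"
    proof (rule self_adjointI)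
      show "bounded_linear Q"
        unfolding Q_def S_def S'_def
        using bounded_linear_compose[OF blS blS] by simp
      show "Q (c *\<^sub>C x) = c *\<^sub>C Q x" for c x
        by (simp add: Q_def S_def S'_def self_adjointD[OF T] scaleC_diff_right scaleC_scaleC mult.commute)
      show "inner (Q x) y = inner x (Q y)" for x y
        by (simp add: adj flip: SS') (metis adj inner_commute Q_def SS')
    qed
    \<comment> \<open><Tx, x> is real, hence Im <Sx, x> = - Im z |x|^2, and Cauchy-Schwarz bounds
      the left side by |Sx| |x|.\<close>
    have "\<bar>Im z\<bar> * norm x \<le> norm (S x)" for x
    proof (cases "x = 0")
      case False
      have "cinner (T x) x = cinner x (T x)"
        using T by (simp add: self_adjoint_ops_def)
      then have "Im (cinner (T x) x) = 0"
        using cinner_commute[of x "T x"] by (simp add: complex_eq_iff)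
      moreover have "cinner (S x) x = cinner (T x) x + cinner ((- z) *\<^sub>C x) x"
        unfolding cinner_add_left[symmetric]
        by (metis S_def diff_conv_add_uminus mult.commute mult_minus1_right scaleC_minus_one
            scaleC_scaleC)
      moreover have "Im (cinner x x) = 0" "Re (cinner x x) = (norm x)\<^sup>2"
        using cinner_commute[of x x] by (simp_all add: complex_eq_iff power2_norm_eq_inner inner_eq_Re_cinner)
      ultimately have "Im (cinner (S x) x) = - Im z * (norm x)\<^sup>2"
        by (simp add: cinner_scaleC_left)
      then have "inner (S x) (\<i> *\<^sub>C x) = - Im z * (norm x)\<^sup>2"
        by (simp add: cinner_eq_inner)
      then have "\<bar>Im z\<bar> * (norm x)\<^sup>2 \<le> norm (S x) * norm x"
        using Cauchy_Schwarz_ineq2[of "S x" "\<i> *\<^sub>C x"] by (simp add: abs_mult)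
      with False show ?thesis
        by (simp add: power2_eq_square)
    qed simp
    then have S2: "(Im z)\<^sup>2 * (norm x)\<^sup>2 \<le> (norm (S x))\<^sup>2" for x
      using power_mono[of "\<bar>Im z\<bar> * norm x" "norm (S x)" 2] by (simp add: power_mult_distrib)
    have form: "inner (Q x) x = (norm (S x))\<^sup>2" for x
      unfolding Q_def by (metis adj inner_commute power2_norm_eq_inner)
    have "op_invertible univ_hspace Q"
    proof (rule self_adjoint_invertibleI[OF Q])
      show "(Im z)\<^sup>2 > 0"
        using False by simp
      show "(Im z)\<^sup>2 * norm x \<le> norm (Q x)" for x
        using S2[of x] by (intro form_lower_imp_bounded_below) (simp add: form)
    qed
    then obtain R where R: "R \<in> bounded_ops univ_hspace" "\<And>x. R (Q x) = x" "\<And>x. Q (R x) = x"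
      by (auto simp: op_invertible_def fun_eq_iff)
    have "S' (c *\<^sub>C x) = c *\<^sub>C S' x" for c x
      by (simp add: S'_def self_adjointD[OF T] scaleC_diff_right scaleC_scaleC mult.commute)
    moreover have "bounded_linear S'"
      unfolding S'_def by (rule blS)
    ultimately have "(\<lambda>x. R (S' x)) \<in> bounded_ops univ_hspace"
      using R(1) bounded_linear_compose[of R S'] by (auto simp: bounded_ops_iff)
    moreover have "R (S' (S x)) = x" for x
      using R(2) by (simp add: Q_def)
    \<comment> \<open>\<open>S\<close> commutes with Q = S'S = SS', hence with its inverse
      \<open>R\<close>, so that S R S' = R S S' = R Q.\<close>
    moreover have "S (R (S' x)) = x" for x
      by (metis Q_def R(2,3) SS')
    ultimately have "op_invertible univ_hspace S"
      unfolding op_invertible_def by (intro bexI[of _ "\<lambda>x. R (S' x)"]) (simp_all add: fun_eq_iff)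
    with z show ?thesis
      by (simp add: op_spectrum_def S_def)
  qed
  then show ?thesis
    by (auto simp: spectrum_in_def)
qed

section \<open>Polynomials of a self-adjoint operator\<close>

lemma poly_op_0 [simp]: "poly_op univ_hspace 0 T = (\<lambda>x :: 'a::chilbert_space. 0)"
  by (simp add: poly_op_def)

lemma poly_op_pCons:
  fixes T :: "'a::chilbert_space \<Rightarrow> 'a"
  assumes "T \<in> self_adjoint_ops univ_hspace"
  shows "poly_op univ_hspace (pCons a p) T = (\<lambda>x. a *\<^sub>R x + T (poly_op univ_hspace p T x))"
proof (cases "a = 0 \<and> p = 0")
  case True
  then show ?thesis
    by (simp add: self_adjointD(7)[OF assms])
next
  case False
  then show ?thesis
    by (cases "p = 0") (auto simp: poly_op_def)
qed

lemma poly_op_const: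
  fixes T :: "'a::chilbert_space \<Rightarrow> 'a"
  assumes "T \<in> self_adjoint_ops univ_hspace"
  shows "poly_op univ_hspace [:a:] T x = a *\<^sub>R x"
  by (simp add: poly_op_pCons[OF assms] self_adjointD(7)[OF assms])

lemma poly_op_add:
  fixes T :: "'a::chilbert_space \<Rightarrow> 'a"
  assumes "T \<in> self_adjoint_ops univ_hspace"
  shows "poly_op univ_hspace (p + q) T x = poly_op univ_hspace p T x + poly_op univ_hspace q T x"
  by (induction p q rule: poly_induct2)
    (simp_all add: poly_op_pCons[OF assms] self_adjointD[OF assms] algebra_simps)

lemma poly_op_smult:
  fixes T :: "'a::chilbert_space \<Rightarrow> 'a"
  assumes "T \<in> self_adjoint_ops univ_hspace"
  shows "poly_op univ_hspace (smult c p) T x = c *\<^sub>R poly_op univ_hspace p T x"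
  by (induction p)
    (simp_all add: poly_op_pCons[OF assms] self_adjointD[OF assms] algebra_simps)

lemma poly_op_diff:
  fixes T :: "'a::chilbert_space \<Rightarrow> 'a"
  assumes "T \<in> self_adjoint_ops univ_hspace"
  shows "poly_op univ_hspace (p - q) T x = poly_op univ_hspace p T x - poly_op univ_hspace q T x"
  using poly_op_add[OF assms, of "p - q" q x] by simp

lemma poly_op_mult:
  fixes T :: "'a::chilbert_space \<Rightarrow> 'a"
  assumes "T \<in> self_adjoint_ops univ_hspace"
  shows "poly_op univ_hspace (p * q) T x = poly_op univ_hspace p T (poly_op univ_hspace q T x)"
  by (induction p)
    (simp_all add: poly_op_pCons[OF assms] poly_op_add[OF assms] poly_op_smult[OF assms])

lemma poly_op_X:
  fixes T :: "'a::chilbert_space \<Rightarrow> 'a"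
  assumes "T \<in> self_adjoint_ops univ_hspace"
  shows "poly_op univ_hspace [:0, 1:] T x = T x"
  by (simp add: poly_op_pCons[OF assms] self_adjointD[OF assms])

lemma poly_op_commute:
  fixes T :: "'a::chilbert_space \<Rightarrow> 'a"
  assumes "T \<in> self_adjoint_ops univ_hspace"
  shows "T (poly_op univ_hspace p T x) = poly_op univ_hspace p T (T x)"
  using poly_op_mult[OF assms, of p "[:0, 1:]" x] poly_op_mult[OF assms, of "[:0, 1:]" p x]
  by (simp add: poly_op_X[OF assms] mult.commute)

lemma poly_op_self_adjoint:
  fixes T :: "'a::chilbert_space \<Rightarrow> 'a"
  assumes "T \<in> self_adjoint_ops univ_hspace"
  shows "poly_op univ_hspace p T \<in> self_adjoint_ops univ_hspace"
proof (induction p)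
  case 0
  show ?case
    by (intro self_adjointI) simp_all
next
  case (pCons a p)
  note T = self_adjointD[OF assms] and S = self_adjointD[OF pCons.IH]
  have "bounded_linear (\<lambda>x. a *\<^sub>R x + T (poly_op univ_hspace p T x))"
    by (intro bounded_linear_add bounded_linear_const_scaleR bounded_linear_ident
        bounded_linear_compose[OF T(1) S(1)])
  then show ?case
    by (intro self_adjointI)
      (simp_all add: poly_op_pCons[OF assms] T S inner_add_left inner_add_right scaleC_add_right
        scaleC_scaleR poly_op_commute[OF assms] del: T(1))
qed

lemma poly_op_eigenvector:
  fixes T :: "'a::chilbert_space \<Rightarrow> 'a"
  assumes "T \<in> self_adjoint_ops univ_hspace" "T x = t *\<^sub>R x"
  shows "poly_op univ_hspace p T x = poly p t *\<^sub>R x"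
  by (induction p)
    (simp_all add: poly_op_pCons[OF assms(1)] self_adjointD[OF assms(1)] assms(2) algebra_simps)

section \<open>Real factorization of polynomials and lower bounds for q(T)\<close>

lemma map_poly_of_real_mult:
  "map_poly complex_of_real (p * q) = map_poly of_real p * map_poly of_real q"
proof (induction p)
  case (pCons a p)
  have "map_poly complex_of_real (p + q) = map_poly of_real p + map_poly of_real q" for p q
    by (intro poly_eqI) (simp add: coeff_map_poly)
  moreover have "map_poly complex_of_real (smult c p) = smult (of_real c) (map_poly of_real p)" for c p
    by (intro poly_eqI) (simp add: coeff_map_poly)
  ultimately show ?case
    using pCons by (simp add: map_poly_pCons)
qed simp

text \<open>The divisor is (X - z)(X - cnj z). The remainder of \<open>q\<close> modulo it is a real
  c + dX that vanishes at the nonreal \<open>z\<close>, which forces d = 0 and then c = 0.\<close>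

lemma real_poly_complex_root_factor:
  assumes "poly (map_poly complex_of_real q) z = 0" "Im z \<noteq> 0"
  shows "[:(Re z)\<^sup>2 + (Im z)\<^sup>2, - 2 * Re z, 1:] dvd q"
proof -
  define D :: "real poly" where "D = [:(Re z)\<^sup>2 + (Im z)\<^sup>2, - 2 * Re z, 1:]"
  have D: "poly (map_poly complex_of_real D) z = 0"
    by (simp add: D_def map_poly_pCons complex_eq_iff power2_eq_square algebra_simps)
  have "q mod D = 0 \<or> degree (q mod D) < 2"
    using degree_mod_less[of D q] by (simp add: D_def numeral_2_eq_2)
  then have "degree (q mod D) < 2"
    by auto
  then obtain c d where cd: "q mod D = [:c, d:]"
    by (metis degree_0 degree_pCons_eq less_2_cases_iff nat_neq_iff pCons_cases not_less_eq
        degree_eq_zeroE Suc_inject less_Suc_eq numeral_2_eq_2 pCons_0_0)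
  have "map_poly complex_of_real q =
      map_poly of_real (q div D) * map_poly of_real D + map_poly of_real (q mod D)"
  proof -
    have "map_poly complex_of_real (p + r) = map_poly of_real p + map_poly of_real r" for p r
      by (intro poly_eqI) (simp add: coeff_map_poly)
    from this[of "(q div D) * D" "q mod D"] show ?thesis
      by (simp add: map_poly_of_real_mult)
  qed
  then have "of_real c + of_real d * z = 0"
    using assms(1) D by (simp add: cd map_poly_pCons mult.commute)
  then have "c = 0" "d = 0"
    using assms(2) by (auto simp: complex_eq_iff)
  then show ?thesis
    using cd by (auto simp: D_def dvd_eq_mod_eq_0)
qed

text \<open>One half of the spectral mapping theorem, by splitting off real irreducible factors. A
  linear factor X - t has \<open>t\<close> outside the spectrum, hence a lower bound; a quadratic
  factor gives (T - Re z)^2 + (Im z)^2, whose form is at least (Im z)^2 |x|^2. Lower bounds multiply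
  under composition.\<close>

lemma poly_op_bounded_below:
  fixes T :: "'a::chilbert_space \<Rightarrow> 'a"
  assumes T: "T \<in> self_adjoint_ops univ_hspace"
    and "q \<noteq> 0" "\<And>t. t \<in> real_spectrum univ_hspace T \<Longrightarrow> poly q t \<noteq> 0"
  shows "\<exists>c>0. \<forall>x. c * norm x \<le> norm (poly_op univ_hspace q T x)"
  using assms(2,3)
proof (induction "degree q" arbitrary: q rule: less_induct)
  case less
  have step: ?case
    if q: "q = d * r" and deg: "degree d > 0"
      and d: "c > 0" "\<And>x. c * norm x \<le> norm (poly_op univ_hspace d T x)" for d r c
  proof -
    have nz: "d \<noteq> 0" "r \<noteq> 0"
      using less.prems(1) q by auto
    then have "degree r < degree q"
      using q deg by (simp add: degree_mult_eq)
    then obtain e where e: "e > 0" "\<And>x. e * norm x \<le> norm (poly_op univ_hspace r T x)"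
      using less.hyps[of r] less.prems(2) nz(2) by (auto simp: q)
    have "c * e * norm x \<le> norm (poly_op univ_hspace q T x)" for x
    proof -
      have "c * (e * norm x) \<le> c * norm (poly_op univ_hspace r T x)"
        using e(2) d(1) by (intro mult_left_mono) auto
      also have "\<dots> \<le> norm (poly_op univ_hspace q T x)"
        unfolding q poly_op_mult[OF T] by (rule d(2))
      finally show ?thesis
        by (simp add: mult.assoc)
    qed
    with d(1) e(1) show ?thesis
      by (intro exI[of _ "c * e"]) simp
  qed
  show ?case
  proof (cases "degree q = 0")
    case True
    then obtain c where c: "q = [:c:]"
      by (rule degree_eq_zeroE)
    with less.prems(1) show ?thesis
      by (intro exI[of _ "\<bar>c\<bar>"]) (simp add: poly_op_const[OF T])
  next
    case False
    have "degree (map_poly complex_of_real q) = degree q"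
      by (rule degree_map_poly) simp
    then obtain z where z: "poly (map_poly complex_of_real q) z = 0"
      using False fundamental_theorem_of_algebra_alt[of "map_poly complex_of_real q"]
      by (metis degree_pCons_0)
    show ?thesis
    proof (cases "Im z = 0")
      case True
      have "poly (map_poly complex_of_real q) (of_real t) = of_real (poly q t)" for t
        by (induction q) (simp_all add: map_poly_pCons)
      moreover have "z = of_real (Re z)"
        using True by (simp add: complex_eq_iff)
      ultimately have root: "poly q (Re z) = 0"
        using z by (metis of_real_eq_0_iff)
      then obtain r where r: "q = [:- Re z, 1:] * r"
        by (auto simp: poly_eq_0_iff_dvd)
      have "Re z \<notin> real_spectrum univ_hspace T"
        using less.prems(2) root by blast
      then obtain c where "c > 0" "\<And>x. c * norm x \<le> norm (T x - Re z *\<^sub>R x)"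
        using bounded_below_off_real_spectrum by blast
      then show ?thesis
        by (intro step[OF r, of c]) (simp_all add: poly_op_pCons[OF T] self_adjointD[OF T])
    next
      case False
      then obtain r where r: "q = [:(Re z)\<^sup>2 + (Im z)\<^sup>2, - 2 * Re z, 1:] * r"
        using real_poly_complex_root_factor[OF z] by (auto simp: dvd_def)
      have "(Im z)\<^sup>2 * norm x \<le>
          norm (poly_op univ_hspace [:(Re z)\<^sup>2 + (Im z)\<^sup>2, - 2 * Re z, 1:] T x)" for x
      proof (rule form_lower_imp_bounded_below)
        have "inner (poly_op univ_hspace [:(Re z)\<^sup>2 + (Im z)\<^sup>2, - 2 * Re z, 1:] T x) x =
            (norm (T x - Re z *\<^sub>R x))\<^sup>2 + (Im z)\<^sup>2 * (norm x)\<^sup>2"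
          unfolding power2_norm_eq_inner
          by (simp add: poly_op_pCons[OF T] self_adjointD[OF T] inner_add_left inner_diff_left
              inner_diff_right inner_commute algebra_simps power2_eq_square)
        then show "(Im z)\<^sup>2 * (norm x)\<^sup>2 \<le>
            \<bar>inner (poly_op univ_hspace [:(Re z)\<^sup>2 + (Im z)\<^sup>2, - 2 * Re z, 1:] T x) x\<bar>"
          by simp
      qed
      with False show ?thesis
        by (intro step[OF r, of "(Im z)\<^sup>2"]) simp_all
    qed
  qed
qed

section \<open>The operator norm and the spectral bound for p(T)\<close>

lemma op_norm_univ_hspace:
  fixes T :: "'a::chilbert_space \<Rightarrow> 'a"
  shows "op_norm univ_hspace T = (SUP x\<in>{x. norm x \<le> 1}. norm (T x))"
  by (simp add: op_norm_def)

lemma op_norm_le: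
  fixes T :: "'a::chilbert_space \<Rightarrow> 'a"
  assumes "0 \<le> K" "\<And>x. norm (T x) \<le> K * norm x"
  shows "op_norm univ_hspace T \<le> K"
  unfolding op_norm_univ_hspace
proof (rule cSUP_least)
  show "{x::'a. norm x \<le> 1} \<noteq> {}"
    by (auto intro: exI[of _ 0])
  fix x :: 'a assume "x \<in> {x. norm x \<le> 1}"
  then show "norm (T x) \<le> K"
    using assms(2)[of x] mult_left_le[of "norm x" K] assms(1) by simp
qed

lemma norm_le_op_norm_unit:
  fixes T :: "'a::chilbert_space \<Rightarrow> 'a"
  assumes "T \<in> bounded_ops univ_hspace" "norm x \<le> 1"
  shows "norm (T x) \<le> op_norm univ_hspace T"
proof -
  obtain K where K: "K > 0" "\<And>x. norm (T x) \<le> norm x * K"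
    using assms(1) bounded_linear.pos_bounded[of T] by (auto simp: bounded_ops_iff)
  have "bdd_above ((\<lambda>x. norm (T x)) ` {x. norm x \<le> 1})"
    using K by (intro bdd_aboveI2[of _ _ K]) (metis mem_Collect_eq mult_right_le_one_le
        mult.commute norm_ge_zero order.trans less_imp_le)
  then show ?thesis
    unfolding op_norm_univ_hspace using assms(2) by (intro cSUP_upper) auto
qed

lemma norm_le_op_norm:
  fixes T :: "'a::chilbert_space \<Rightarrow> 'a"
  assumes T: "T \<in> bounded_ops univ_hspace"
  shows "norm (T x) \<le> op_norm univ_hspace T * norm x"
proof -
  interpret bounded_linear T
    using T by (simp add: bounded_ops_iff)
  show ?thesis
  proof (cases "x = 0")
    case False
    then show ?thesis
      using norm_le_op_norm_unit[OF T, of "(1 / norm x) *\<^sub>R x"] by (simp add: scaleR field_simps)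
  qed (simp add: zero)
qed

lemma op_norm_nonneg:
  fixes T :: "'a::chilbert_space \<Rightarrow> 'a"
  assumes "T \<in> bounded_ops univ_hspace"
  shows "0 \<le> op_norm univ_hspace T"
  using norm_le_op_norm_unit[OF assms, of 0] norm_ge_zero[of "T 0"] by (simp del: norm_ge_zero)

lemma self_adjoint_bounded_op: "T \<in> self_adjoint_ops H \<Longrightarrow> T \<in> bounded_ops H"
  by (simp add: self_adjoint_ops_def)

(* Vectors at which S nearly attains its norm N are nearly annihilated by N^2 - S^2. *)
lemma self_adjoint_norm_not_bounded_below:
  fixes S :: "'a::chilbert_space \<Rightarrow> 'a"
  assumes nz: "(v :: 'a) \<noteq> 0" and S: "S \<in> self_adjoint_ops univ_hspace"
    and N: "N = op_norm univ_hspace S" and c: "c > 0"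
    and bb: "\<And>x. c * norm x \<le> norm (N\<^sup>2 *\<^sub>R x - S (S x))"
  shows False
proof -
  have N0: "0 \<le> N"
    using op_norm_nonneg self_adjoint_bounded_op[OF S] N by blast
  have le: "norm (S x) \<le> N * norm x" for x
    unfolding N by (rule norm_le_op_norm[OF self_adjoint_bounded_op[OF S]])
  have key: "c\<^sup>2 * (norm x)\<^sup>2 \<le> N\<^sup>2 * (N\<^sup>2 * (norm x)\<^sup>2 - (norm (S x))\<^sup>2)" for x
  proof -
    have "(norm (S (S x)))\<^sup>2 \<le> (N * norm (S x))\<^sup>2"
      using le N0 by (intro power_mono) auto
    then have 1: "(norm (S (S x)))\<^sup>2 \<le> N\<^sup>2 * (norm (S x))\<^sup>2"
      by (simp add: power_mult_distrib)
    have "(c * norm x)\<^sup>2 \<le> (norm (N\<^sup>2 *\<^sub>R x - S (S x)))\<^sup>2"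
      using bb c by (intro power_mono) auto
    also have "\<dots> = N\<^sup>2 * N\<^sup>2 * (norm x)\<^sup>2 - 2 * N\<^sup>2 * (norm (S x))\<^sup>2 + (norm (S (S x)))\<^sup>2"
      by (simp add: power2_norm_eq_inner inner_diff_left inner_diff_right inner_commute
          self_adjointD(3)[OF S])
    finally show ?thesis
      using 1 by (simp add: power_mult_distrib algebra_simps)
  qed
  have "N \<noteq> 0"
    using key[of v] nz c by (auto simp: mult_le_0_iff)
  with N0 have "N > 0"
    by simp
  \<comment> \<open>\<open>key\<close> reads |Sx|^2 \<le> (N^2 - c^2/N^2) |x|^2, so \<open>M\<close>
    is a bound for \<open>S\<close> strictly smaller than its norm.\<close>
  define M where "M = sqrt (max 0 (N\<^sup>2 - c\<^sup>2 / N\<^sup>2))"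
  have "M < N"
    unfolding M_def using \<open>N > 0\<close> c by (intro real_less_lsqrt) (auto simp: max_def)
  moreover have "N \<le> M"
    unfolding N
  proof (rule op_norm_le)
    show "M \<ge> 0"
      by (simp add: M_def)
    fix x
    have "(norm (S x))\<^sup>2 \<le> (N\<^sup>2 - c\<^sup>2 / N\<^sup>2) * (norm x)\<^sup>2"
      using key[of x] \<open>N > 0\<close> by (simp add: field_simps)
    also have "\<dots> \<le> max 0 (N\<^sup>2 - c\<^sup>2 / N\<^sup>2) * (norm x)\<^sup>2"
      by (intro mult_right_mono) auto
    also have "\<dots> = (M * norm x)\<^sup>2"
      by (simp add: M_def power_mult_distrib)
    finally show "norm (S x) \<le> M * norm x"
      by (rule power2_le_imp_le) (simp add: M_def)
  qed
  ultimately show False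
    by simp
qed

text \<open>On an empty spectrum N^2 - X^2, with \<open>N\<close> the norm of \<open>T\<close>, has
  no zero. Then N^2 - T^2 would be bounded below, against the existence of vectors at which
  \<open>T\<close> nearly attains its norm.\<close>

lemma real_spectrum_nonempty:
  fixes T :: "'a::chilbert_space \<Rightarrow> 'a"
  assumes T: "T \<in> self_adjoint_ops univ_hspace" and nz: "(v :: 'a) \<noteq> 0"
  shows "real_spectrum univ_hspace T \<noteq> {}"
proof
  assume empty: "real_spectrum univ_hspace T = {}"
  let ?q = "[:(op_norm univ_hspace T)\<^sup>2, 0, - 1:]"
  obtain c where "c > 0" "\<And>x. c * norm x \<le> norm (poly_op univ_hspace ?q T x)"
    using poly_op_bounded_below[OF T, of ?q] empty by auto
  moreover have "poly_op univ_hspace ?q T x = (op_norm univ_hspace T)\<^sup>2 *\<^sub>R x - T (T x)" for x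
    using self_adjointD(6)[OF T, of "- 1"] by (simp add: poly_op_pCons[OF T] self_adjointD(7)[OF T])
  ultimately show False
    using self_adjoint_norm_not_bounded_below[OF nz T refl, of c] by simp
qed

text \<open>If the norm \<open>N\<close> of S = p(T) exceeded \<open>K\<close>, then N^2 - p^2 would
  have no zero on the spectrum and N^2 - S^2 would be bounded below, which is impossible. This
  estimate turns uniform convergence on the spectrum into norm convergence of operators.\<close>

lemma norm_poly_op_le:
  fixes T :: "'a::chilbert_space \<Rightarrow> 'a"
  assumes T: "T \<in> self_adjoint_ops univ_hspace"
    and K: "0 \<le> K" "\<And>t. t \<in> real_spectrum univ_hspace T \<Longrightarrow> \<bar>poly p t\<bar> \<le> K"
  shows "norm (poly_op univ_hspace p T x) \<le> K * norm x"
proof (cases "x = 0")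
  case True
  then show ?thesis
    by (simp add: self_adjointD(7)[OF poly_op_self_adjoint[OF T]])
next
  case False
  define S where "S = poly_op univ_hspace p T"
  have S: "S \<in> self_adjoint_ops univ_hspace"
    unfolding S_def by (rule poly_op_self_adjoint[OF T])
  define N where "N = op_norm univ_hspace S"
  have "N \<le> K"
  proof (rule ccontr)
    assume "\<not> N \<le> K"
    let ?q = "[:N\<^sup>2:] - p * p"
    have pos: "poly ?q t \<noteq> 0" if "t \<in> real_spectrum univ_hspace T" for t
    proof -
      have "\<bar>poly p t\<bar> < \<bar>N\<bar>"
        using K(2)[OF that] \<open>\<not> N \<le> K\<close> K(1) by linarith
      then have "(poly p t)\<^sup>2 < N\<^sup>2"
        by (simp add: abs_le_square_iff flip: not_le)
      then show ?thesis
        by (simp add: power2_eq_square)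
    qed
    \<comment> \<open>A polynomial without zeros on the spectrum could still be 0 if the spectrum
      were empty.\<close>
    moreover have "?q \<noteq> 0"
      using real_spectrum_nonempty[OF T False] pos by fastforce
    ultimately obtain c where "c > 0" "\<And>x. c * norm x \<le> norm (poly_op univ_hspace ?q T x)"
      using poly_op_bounded_below[OF T, of ?q] by blast
    then show False
      using self_adjoint_norm_not_bounded_below[OF False S N_def, of c]
      by (simp add: poly_op_diff[OF T] poly_op_const[OF T] poly_op_mult[OF T] S_def)
  qed
  have "norm (S x) \<le> N * norm x"
    unfolding N_def by (rule norm_le_op_norm[OF self_adjoint_bounded_op[OF S]])
  also have "\<dots> \<le> K * norm x"
    using \<open>N \<le> K\<close> by (intro mult_right_mono) auto
  finally show ?thesis
    by (simp add: S_def)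
qed

section \<open>Continuous functional calculus\<close>

lemma uniform_poly_approximation:
  fixes K :: "real set"
  assumes "compact K" "continuous_on K f"
  obtains p :: "nat \<Rightarrow> real poly" where "uniform_limit K (\<lambda>n. poly (p n)) f sequentially"
proof -
  have "\<exists>p. \<forall>t\<in>K. \<bar>f t - poly p t\<bar> < e" if "e > 0" for e
  proof -
    obtain g where g: "real_polynomial_function g" "\<And>t. t \<in> K \<Longrightarrow> \<bar>f t - g t\<bar> < e"
      using Stone_Weierstrass_real_polynomial_function[OF assms \<open>e > 0\<close>] by blast
    then obtain a n where "g = (\<lambda>x. \<Sum>i\<le>n. a i * x ^ i)"
      by (auto simp: real_polynomial_function_iff_sum)
    then have "g = poly (\<Sum>i\<le>n. monom (a i) i)"
      by (simp add: fun_eq_iff poly_sum poly_monom)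
    with g(2) show ?thesis
      by blast
  qed
  then have "\<exists>p. \<forall>t\<in>K. \<bar>f t - poly p t\<bar> < 1 / Suc n" for n :: nat
    by simp
  then obtain p where p: "\<And>n t. t \<in> K \<Longrightarrow> \<bar>f t - poly (p n) t\<bar> < 1 / Suc n"
    by metis
  have "uniform_limit K (\<lambda>n. poly (p n)) f sequentially"
  proof (rule uniform_limitI)
    fix e :: real assume "e > 0"
    then have "\<forall>\<^sub>F n in sequentially. 1 / real (Suc n) < e"
      using LIMSEQ_inverse_real_of_nat by (auto simp: inverse_eq_divide intro: order_tendstoD)
    then show "\<forall>\<^sub>F n in sequentially. \<forall>t\<in>K. dist (poly (p n) t) (f t) < e"
    proof eventually_elim
      case (elim n)
      then show ?case
        using p[of _ n] by (auto simp: dist_real_def abs_minus_commute intro: less_trans)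
    qed
  qed
  then show thesis
    by (rule that)
qed

text \<open>The condition under the definite description in \<open>fun_calc\<close>, isolated so
  that existence and uniqueness can be stated, and kept for arbitrary records so that it can be
  transported.\<close>

definition is_fun_calc :: "'a hspace \<Rightarrow> (real \<Rightarrow> real) \<Rightarrow> ('a \<Rightarrow> 'a) \<Rightarrow> ('a \<Rightarrow> 'a) \<Rightarrow> bool"
  where "is_fun_calc H f T S \<longleftrightarrow> S \<in> bounded_ops H \<and>
    (\<forall>p :: nat \<Rightarrow> real poly.
      uniform_limit (real_spectrum H T) (\<lambda>n. poly (p n)) f sequentially \<longrightarrow>
      (\<lambda>n. op_norm H (op_diff H (poly_op H (p n) T) S)) \<longlonglongrightarrow> 0)"

lemma fun_calc_eq: "fun_calc H f T = (THE S. is_fun_calc H f T S)"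
  by (simp add: fun_calc_def is_fun_calc_def)

lemma fun_calc_cong:
  assumes "\<And>t. t \<in> real_spectrum H T \<Longrightarrow> f t = g t"
  shows "fun_calc H f T = fun_calc H g T"
proof -
  have "uniform_limit (real_spectrum H T) P f sequentially \<longleftrightarrow>
      uniform_limit (real_spectrum H T) P g sequentially" for P
    by (rule uniform_limit_cong') (simp_all add: assms)
  then show ?thesis
    by (simp add: fun_calc_eq is_fun_calc_def)
qed

lemma is_fun_calc_tendsto:
  fixes T :: "'a::chilbert_space \<Rightarrow> 'a"
  assumes T: "T \<in> self_adjoint_ops univ_hspace" and S: "is_fun_calc univ_hspace f T S"
    and p: "uniform_limit (real_spectrum univ_hspace T) (\<lambda>n. poly (p n)) f sequentially"
  shows "(\<lambda>n. poly_op univ_hspace (p n) T x) \<longlonglongrightarrow> S x"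
proof -
  let ?D = "\<lambda>n. (\<lambda>x. poly_op univ_hspace (p n) T x - S x)"
  have lim: "(\<lambda>n. op_norm univ_hspace (?D n)) \<longlonglongrightarrow> 0"
    using S p by (simp add: is_fun_calc_def)
  have "?D n \<in> bounded_ops univ_hspace" for n
    using S poly_op_self_adjoint[OF T, of "p n"]
    by (auto simp: is_fun_calc_def self_adjoint_ops_def bounded_ops_iff bounded_linear_sub
        scaleC_diff_right)
  then have "norm (poly_op univ_hspace (p n) T x - S x) \<le> op_norm univ_hspace (?D n) * norm x" for n
    by (rule norm_le_op_norm)
  then have "\<forall>\<^sub>F n in sequentially.
      norm (poly_op univ_hspace (p n) T x - S x) \<le> op_norm univ_hspace (?D n) * norm x"
    by simp
  moreover have "(\<lambda>n. op_norm univ_hspace (?D n) * norm x) \<longlonglongrightarrow> 0"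
    using tendsto_mult_right[OF lim, of "norm x"] by simp
  ultimately have "(\<lambda>n. poly_op univ_hspace (p n) T x - S x) \<longlonglongrightarrow> 0"
    by (rule Lim_null_comparison)
  then show ?thesis
    by (rule LIM_zero_cancel)
qed

text \<open>Polynomials that converge uniformly on the spectrum give a Cauchy sequence of operators;
  \<open>S\<close> is its pointwise limit, and \<open>near\<close>, being uniform on the unit ball,
  makes it a limit in norm. \<open>close\<close> compares two sequences because the definition
  demands the same limit for every approximating sequence.\<close>

lemma is_fun_calc_exists:
  fixes T :: "'a::chilbert_space \<Rightarrow> 'a"
  assumes T: "T \<in> self_adjoint_ops univ_hspace"
    and f: "continuous_on (real_spectrum univ_hspace T) f"
  shows "\<exists>S. is_fun_calc univ_hspace f T S \<and> S \<in> self_adjoint_ops univ_hspace"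
proof -
  let ?K = "real_spectrum univ_hspace T"
  let ?P = "\<lambda>p. poly_op univ_hspace p T"
  note P = poly_op_self_adjoint[OF T]
  have close: "\<exists>N. \<forall>m\<ge>N. \<forall>n\<ge>N. \<forall>x. norm (?P (p m) x - ?P (q n) x) \<le> e * norm x"
    if p: "uniform_limit ?K (\<lambda>n. poly (p n)) f sequentially"
      and q: "uniform_limit ?K (\<lambda>n. poly (q n)) f sequentially" and e: "e > 0" for p q e
  proof -
    obtain N where N: "\<And>n t. n \<ge> N \<Longrightarrow> t \<in> ?K \<Longrightarrow> \<bar>poly (p n) t - f t\<bar> < e / 2 \<and> \<bar>poly (q n) t - f t\<bar> < e / 2"
      using eventually_conj[OF uniform_limitD[OF p, of "e / 2"] uniform_limitD[OF q, of "e / 2"]] e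
      by (auto simp: eventually_sequentially dist_real_def)
    have "norm (?P (p m) x - ?P (q n) x) \<le> e * norm x" if "m \<ge> N" "n \<ge> N" for m n x
    proof -
      have "\<bar>poly (p m - q n) t\<bar> \<le> e" if "t \<in> ?K" for t
      proof -
        have "\<bar>poly (p m) t - f t\<bar> < e / 2" "\<bar>poly (q n) t - f t\<bar> < e / 2"
          using N \<open>m \<ge> N\<close> \<open>n \<ge> N\<close> that by blast+
        then show ?thesis
          unfolding poly_diff by linarith
      qed
      then show ?thesis
        using norm_poly_op_le[OF T, of e "p m - q n" x] e by (simp add: poly_op_diff[OF T])
    qed
    then show ?thesis
      by blast
  qed
  obtain p where p: "uniform_limit ?K (\<lambda>n. poly (p n)) f sequentially"
    using uniform_poly_approximation[OF compact_real_spectrum[OF T] f] by blast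
  have "\<exists>l. (\<lambda>n. ?P (p n) x) \<longlonglongrightarrow> l" for x
  proof -
    have "Cauchy (\<lambda>n. ?P (p n) x)"
    proof (rule CauchyI)
      fix e :: real assume e: "e > 0"
      then have "e / (norm x + 1) > 0"
        by (simp add: add_nonneg_pos)
      then obtain N where
        N: "\<And>m n. m \<ge> N \<Longrightarrow> n \<ge> N \<Longrightarrow> norm (?P (p m) x - ?P (p n) x) \<le> e / (norm x + 1) * norm x"
        using close[OF p p, of "e / (norm x + 1)"] by blast
      moreover have "e * norm x < e * (norm x + 1)"
        using e by simp
      then have "e / (norm x + 1) * norm x < e"
        by (simp add: pos_divide_less_eq add_nonneg_pos)
      ultimately show "\<exists>M. \<forall>m\<ge>M. \<forall>n\<ge>M. norm (?P (p m) x - ?P (p n) x) < e"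
        by (meson le_less_trans)
    qed
    then show ?thesis
      using Cauchy_convergent_iff convergent_def by blast
  qed
  then obtain S where S: "\<And>x. (\<lambda>n. ?P (p n) x) \<longlonglongrightarrow> S x"
    by metis
  have near: "\<exists>N. \<forall>n\<ge>N. \<forall>x. norm (?P (q n) x - S x) \<le> e * norm x"
    if q: "uniform_limit ?K (\<lambda>n. poly (q n)) f sequentially" and e: "e > 0" for q e
  proof -
    obtain N where N: "\<And>m n x. m \<ge> N \<Longrightarrow> n \<ge> N \<Longrightarrow> norm (?P (q n) x - ?P (p m) x) \<le> e * norm x"
      using close[OF q p e] by blast
    have "norm (?P (q n) x - S x) \<le> e * norm x" if "n \<ge> N" for n x
    proof (rule Lim_bounded)
      show "(\<lambda>m. norm (?P (q n) x - ?P (p m) x)) \<longlonglongrightarrow> norm (?P (q n) x - S x)"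
        by (intro tendsto_intros S)
      show "\<forall>m\<ge>N. norm (?P (q n) x - ?P (p m) x) \<le> e * norm x"
        using N that by blast
    qed
    then show ?thesis
      by blast
  qed
  have lin: "S (x + y) = S x + S y" "S (c *\<^sub>C x) = c *\<^sub>C S x" "S (r *\<^sub>R x) = r *\<^sub>R S x"
    "inner (S x) y = inner x (S y)" for x y c r
  proof -
    have scC: "bounded_linear (scaleC c :: 'a \<Rightarrow> 'a)"
      by (intro bounded_linear_intro[of _ "cmod c"])
        (simp_all add: scaleC_add_right scaleC_scaleR mult.commute)
    show "S (x + y) = S x + S y"
      using LIMSEQ_unique[OF S[of "x + y"]] tendsto_add[OF S[of x] S[of y]]
      by (simp add: self_adjointD(4)[OF P])
    show "S (c *\<^sub>C x) = c *\<^sub>C S x"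
      using LIMSEQ_unique[OF S[of "c *\<^sub>C x"]] bounded_linear.tendsto[OF scC S[of x]]
      by (simp add: self_adjointD(2)[OF P])
    show "S (r *\<^sub>R x) = r *\<^sub>R S x"
      using LIMSEQ_unique[OF S[of "r *\<^sub>R x"]] tendsto_scaleR[OF tendsto_const S[of x], of r]
      by (simp add: self_adjointD(6)[OF P])
    show "inner (S x) y = inner x (S y)"
      using LIMSEQ_unique[OF tendsto_inner[OF S[of x] tendsto_const[of y]]]
        tendsto_inner[OF tendsto_const[of x] S[of y]]
      by (simp add: self_adjointD(3)[OF P])
  qed
  obtain N where N: "\<And>x. norm (?P (p N) x - S x) \<le> 1 * norm x"
    using near[OF p, of 1] by auto
  obtain K where K: "\<And>x. norm (?P (p N) x) \<le> norm x * K"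
    using bounded_linear.bounded[OF self_adjointD(1)[OF P]] by blast
  have "norm (S x) \<le> norm x * (K + 1)" for x
    using N[of x] K[of x] norm_triangle_ineq4[of "?P (p N) x" "?P (p N) x - S x"]
    by (simp add: algebra_simps)
  then have "bounded_linear S"
    by (intro bounded_linear_intro[of S "K + 1"]) (simp_all add: lin)
  then have sa: "S \<in> self_adjoint_ops univ_hspace"
    by (intro self_adjointI) (simp_all add: lin)
  have "(\<lambda>n. op_norm univ_hspace (\<lambda>x. ?P (q n) x - S x)) \<longlonglongrightarrow> 0"
    if q: "uniform_limit ?K (\<lambda>n. poly (q n)) f sequentially" for q
  proof (rule LIMSEQ_I)
    fix e :: real assume e: "e > 0"
    then obtain N where N: "\<And>n x. n \<ge> N \<Longrightarrow> norm (?P (q n) x - S x) \<le> e / 2 * norm x"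
      using near[OF q, of "e / 2"] by auto
    have "norm (op_norm univ_hspace (\<lambda>x. ?P (q n) x - S x) - 0) < e" if "n \<ge> N" for n
      using op_norm_le[of "e / 2" "\<lambda>x. ?P (q n) x - S x"] N[OF that] e
        op_norm_nonneg[OF self_adjoint_bounded_op[OF self_adjoint_diff[OF P sa]], of "q n"] by simp
    then show "\<exists>N. \<forall>n\<ge>N. norm (op_norm univ_hspace (\<lambda>x. ?P (q n) x - S x) - 0) < e"
      by blast
  qed
  then have "is_fun_calc univ_hspace f T S"
    using sa by (simp add: is_fun_calc_def self_adjoint_bounded_op)
  with sa show ?thesis
    by blast
qed

text \<open>Uniqueness rests on the existence of at least one approximating sequence, without which
  the defining condition would be vacuous.\<close>

lemma ex1_is_fun_calc:
  fixes T :: "'a::chilbert_space \<Rightarrow> 'a"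
  assumes T: "T \<in> self_adjoint_ops univ_hspace"
    and f: "continuous_on (real_spectrum univ_hspace T) f"
  shows "\<exists>!S. is_fun_calc univ_hspace f T S"
proof -
  obtain p where p: "uniform_limit (real_spectrum univ_hspace T) (\<lambda>n. poly (p n)) f sequentially"
    using uniform_poly_approximation[OF compact_real_spectrum[OF T] f] by blast
  have "S = S'" if "is_fun_calc univ_hspace f T S" "is_fun_calc univ_hspace f T S'" for S S'
    using that[THEN is_fun_calc_tendsto[OF T _ p]] LIMSEQ_unique by blast
  then show ?thesis
    using is_fun_calc_exists[OF assms] by blast
qed

context
  fixes T :: "'a::chilbert_space \<Rightarrow> 'a"
  assumes T: "T \<in> self_adjoint_ops univ_hspace"
begin

lemma is_fun_calc_fun_calc:
  assumes "continuous_on (real_spectrum univ_hspace T) f"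
  shows "is_fun_calc univ_hspace f T (fun_calc univ_hspace f T)"
  unfolding fun_calc_eq by (rule theI'[OF ex1_is_fun_calc[OF T assms]])

lemma fun_calc_self_adjoint:
  assumes "continuous_on (real_spectrum univ_hspace T) f"
  shows "fun_calc univ_hspace f T \<in> self_adjoint_ops univ_hspace"
proof -
  obtain S where S: "is_fun_calc univ_hspace f T S" "S \<in> self_adjoint_ops univ_hspace"
    using is_fun_calc_exists[OF T assms] by blast
  then have "fun_calc univ_hspace f T = S"
    using ex1_is_fun_calc[OF T assms] is_fun_calc_fun_calc[OF assms] by blast
  with S show ?thesis
    by simp
qed

lemma fun_calc_tendsto:
  assumes "continuous_on (real_spectrum univ_hspace T) f"
    and "uniform_limit (real_spectrum univ_hspace T) (\<lambda>n. poly (p n)) f sequentially"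
  shows "(\<lambda>n. poly_op univ_hspace (p n) T x) \<longlonglongrightarrow> fun_calc univ_hspace f T x"
  by (rule is_fun_calc_tendsto[OF T is_fun_calc_fun_calc[OF assms(1)] assms(2)])

lemma fun_calc_poly:
  "fun_calc univ_hspace (poly p) T x = poly_op univ_hspace p T x"
proof -
  have "(\<lambda>n::nat. poly_op univ_hspace p T x) \<longlonglongrightarrow> fun_calc univ_hspace (poly p) T x"
    by (rule fun_calc_tendsto) (auto intro!: continuous_intros uniform_limit_const)
  then show ?thesis
    by (simp add: LIMSEQ_const_iff)
qed

lemma fun_calc_affine:
  "fun_calc univ_hspace (\<lambda>t. a + b * t) T x = a *\<^sub>R x + b *\<^sub>R T x"
proof -
  have "(\<lambda>t. a + b * t) = poly [:a, b:]"
    by (auto simp: fun_eq_iff)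
  then show ?thesis
    using fun_calc_poly[of "[:a, b:]" x]
    by (simp add: poly_op_pCons[OF T] self_adjointD[OF T])
qed

lemma fun_calc_diff:
  assumes f: "continuous_on (real_spectrum univ_hspace T) f"
    and g: "continuous_on (real_spectrum univ_hspace T) g"
  shows "fun_calc univ_hspace (\<lambda>t. f t - g t) T x = fun_calc univ_hspace f T x - fun_calc univ_hspace g T x"
proof -
  obtain p where p: "uniform_limit (real_spectrum univ_hspace T) (\<lambda>n. poly (p n)) f sequentially"
    using uniform_poly_approximation[OF compact_real_spectrum[OF T] f] by blast
  obtain q where q: "uniform_limit (real_spectrum univ_hspace T) (\<lambda>n. poly (q n)) g sequentially"
    using uniform_poly_approximation[OF compact_real_spectrum[OF T] g] by blast
  have "uniform_limit (real_spectrum univ_hspace T) (\<lambda>n. poly (p n - q n)) (\<lambda>t. f t - g t) sequentially"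
    using uniform_limit_minus[OF p q] by (simp add: poly_diff[abs_def])
  from fun_calc_tendsto[OF continuous_on_diff[OF f g] this, of x]
    tendsto_diff[OF fun_calc_tendsto[OF f p, of x] fun_calc_tendsto[OF g q, of x]]
  show ?thesis
    unfolding poly_op_diff[OF T] by (rule LIMSEQ_unique)
qed

lemma fun_calc_mult:
  assumes f: "continuous_on (real_spectrum univ_hspace T) f"
    and g: "continuous_on (real_spectrum univ_hspace T) g"
  shows "fun_calc univ_hspace (\<lambda>t. f t * g t) T x = fun_calc univ_hspace f T (fun_calc univ_hspace g T x)"
proof -
  let ?K = "real_spectrum univ_hspace T"
  obtain p where p: "uniform_limit ?K (\<lambda>n. poly (p n)) f sequentially"
    using uniform_poly_approximation[OF compact_real_spectrum[OF T] f] by blast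
  obtain q where q: "uniform_limit ?K (\<lambda>n. poly (q n)) g sequentially"
    using uniform_poly_approximation[OF compact_real_spectrum[OF T] g] by blast
  have "uniform_limit ?K (\<lambda>n. poly (p n * q n)) (\<lambda>t. f t * g t) sequentially"
    using bounded_bilinear.bounded_uniform_limit[OF bounded_bilinear_mult p q]
      compact_imp_bounded[OF compact_continuous_image[OF f compact_real_spectrum[OF T]]]
      compact_imp_bounded[OF compact_continuous_image[OF g compact_real_spectrum[OF T]]]
    by (simp add: poly_mult[abs_def])
  note lim = fun_calc_tendsto[OF continuous_on_mult[OF f g] this]
  \<comment> \<open>In p_n(T) q_n(T) x both the operator and its argument vary. Moving p_n(T) to the
    other side of the inner product leaves two pointwise limits.\<close>
  have "inner (fun_calc univ_hspace (\<lambda>t. f t * g t) T x) y =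
      inner (fun_calc univ_hspace f T (fun_calc univ_hspace g T x)) y" for y
  proof (rule LIMSEQ_unique)
    show "(\<lambda>n. inner (poly_op univ_hspace (p n * q n) T x) y) \<longlonglongrightarrow>
        inner (fun_calc univ_hspace (\<lambda>t. f t * g t) T x) y"
      by (intro tendsto_intros lim)
    have "(\<lambda>n. inner (poly_op univ_hspace (q n) T x) (poly_op univ_hspace (p n) T y)) \<longlonglongrightarrow>
        inner (fun_calc univ_hspace g T x) (fun_calc univ_hspace f T y)"
      by (intro tendsto_inner fun_calc_tendsto f g p q)
    then show "(\<lambda>n. inner (poly_op univ_hspace (p n * q n) T x) y) \<longlonglongrightarrow>
        inner (fun_calc univ_hspace f T (fun_calc univ_hspace g T x)) y"
      by (simp add: poly_op_mult[OF T] self_adjointD(3)[OF poly_op_self_adjoint[OF T]]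
          self_adjointD(3)[OF fun_calc_self_adjoint[OF f]])
  qed
  then show ?thesis
    using vector_eq_rdot by blast
qed

text \<open>On the spectrum f = r^2 with r = sqrt |f|, so <f(T) x, x> = |r(T) x|^2 because r(T) is
  self-adjoint.\<close>

lemma fun_calc_nonneg:
  assumes f: "continuous_on (real_spectrum univ_hspace T) f"
    and nonneg: "\<And>t. t \<in> real_spectrum univ_hspace T \<Longrightarrow> 0 \<le> f t"
  shows "0 \<le> inner (fun_calc univ_hspace f T x) x"
proof -
  let ?r = "\<lambda>t. sqrt \<bar>f t\<bar>"
  have r: "continuous_on (real_spectrum univ_hspace T) ?r"
    by (intro continuous_intros f)
  have "fun_calc univ_hspace f T = fun_calc univ_hspace (\<lambda>t. ?r t * ?r t) T"
    by (rule fun_calc_cong) (simp add: nonneg)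
  then have "fun_calc univ_hspace f T x = fun_calc univ_hspace ?r T (fun_calc univ_hspace ?r T x)"
    by (simp only: fun_calc_mult[OF r r])
  then show ?thesis
    using self_adjointD(3)[OF fun_calc_self_adjoint[OF r], of "fun_calc univ_hspace ?r T x" x]
    by simp
qed

lemma fun_calc_mono:
  assumes f: "continuous_on (real_spectrum univ_hspace T) f"
    and g: "continuous_on (real_spectrum univ_hspace T) g"
    and le: "\<And>t. t \<in> real_spectrum univ_hspace T \<Longrightarrow> f t \<le> g t"
  shows "inner (fun_calc univ_hspace f T x) x \<le> inner (fun_calc univ_hspace g T x) x"
  using fun_calc_nonneg[OF continuous_on_diff[OF g f], of x] le
  by (simp add: fun_calc_diff[OF g f] inner_diff_left)

text \<open>An affine function of \<open>T\<close> has the explicit form a |x|^2 + b <Tx, x>. This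
  lemma and its mirror image carry the scalar estimates for \<open>f\<close> and \<Phi> over to
  operators.\<close>

lemma fun_calc_le_affine:
  assumes f: "continuous_on (real_spectrum univ_hspace T) f"
    and le: "\<And>t. t \<in> real_spectrum univ_hspace T \<Longrightarrow> f t \<le> a + b * t"
  shows "inner (fun_calc univ_hspace f T x) x \<le> a * (norm x)\<^sup>2 + b * inner (T x) x"
proof -
  have aff: "continuous_on (real_spectrum univ_hspace T) (\<lambda>t. a + b * t)"
    by (intro continuous_intros)
  show ?thesis
    using fun_calc_mono[OF f aff le, of x]
    by (simp add: fun_calc_affine inner_add_left power2_norm_eq_inner)
qed

lemma fun_calc_ge_affine:
  assumes f: "continuous_on (real_spectrum univ_hspace T) f"
    and le: "\<And>t. t \<in> real_spectrum univ_hspace T \<Longrightarrow> a + b * t \<le> f t"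
  shows "a * (norm x)\<^sup>2 + b * inner (T x) x \<le> inner (fun_calc univ_hspace f T x) x"
proof -
  have aff: "continuous_on (real_spectrum univ_hspace T) (\<lambda>t. a + b * t)"
    by (intro continuous_intros)
  show ?thesis
    using fun_calc_mono[OF aff f le, of x]
    by (simp add: fun_calc_affine inner_add_left power2_norm_eq_inner)
qed

lemma fun_calc_eigenvector:
  assumes f: "continuous_on (real_spectrum univ_hspace T) f" and x: "T x = t *\<^sub>R x"
  shows "fun_calc univ_hspace f T x = f t *\<^sub>R x"
proof (cases "x = 0")
  case True
  then show ?thesis
    by (simp add: self_adjointD(7)[OF fun_calc_self_adjoint[OF f]])
next
  case False
  \<comment> \<open>T - t annihilates the nonzero \<open>x\<close>. Having \<open>t\<close> in the
    spectrum makes uniform convergence there give p_n(t) \<longlonglongrightarrow> f(t).\<close>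
  have t: "t \<in> real_spectrum univ_hspace T"
  proof (rule ccontr)
    assume "t \<notin> real_spectrum univ_hspace T"
    then obtain c where "c > 0" "\<And>x. c * norm x \<le> norm (T x - t *\<^sub>R x)"
      using bounded_below_off_real_spectrum by blast
    from this(1) this(2)[of x] show False
      using x False by (simp add: mult_le_0_iff)
  qed
  obtain p where p: "uniform_limit (real_spectrum univ_hspace T) (\<lambda>n. poly (p n)) f sequentially"
    using uniform_poly_approximation[OF compact_real_spectrum[OF T] f] by blast
  have "(\<lambda>n. poly (p n) t *\<^sub>R x) \<longlonglongrightarrow> fun_calc univ_hspace f T x"
    using fun_calc_tendsto[OF f p, of x] by (simp add: poly_op_eigenvector[OF T x])
  moreover have "(\<lambda>n. poly (p n) t *\<^sub>R x) \<longlonglongrightarrow> f t *\<^sub>R x"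
    by (intro tendsto_intros tendsto_uniform_limitI[OF p t])
  ultimately show ?thesis
    by (rule LIMSEQ_unique)
qed

end

section \<open>Transport along an injection\<close>

text \<open>The structure of \<open>'b\<close> copied onto the set \<open>range j\<close>. Only
  injectivity of \<open>j\<close> matters; the copy has no relation to any operations that
  \<open>'a\<close> may carry itself.\<close>

definition push_hspace :: "('b::chilbert_space \<Rightarrow> 'a) \<Rightarrow> 'a hspace"
  where "push_hspace j = \<lparr>hcarrier = range j, hzero = j 0, hadd = \<lambda>x y. j (inv j x + inv j y),
    hscale = \<lambda>c x. j (c *\<^sub>C inv j x), hinner = \<lambda>x y. cinner (inv j x) (inv j y)\<rparr>"

text \<open>Restricted to \<open>range j\<close> because operators on a record are extensional
  functions.\<close>

definition push_op :: "('b \<Rightarrow> 'a) \<Rightarrow> ('b \<Rightarrow> 'b) \<Rightarrow> 'a \<Rightarrow> 'a"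
  where "push_op j M = (\<lambda>x\<in>range j. j (M (inv j x)))"

context
  fixes j :: "'b::chilbert_space \<Rightarrow> 'a"
  assumes inj: "inj j"
begin

lemma push_hspace_simps:
  "hcarrier (push_hspace j) = range j" "hzero (push_hspace j) = j 0"
  "hadd (push_hspace j) (j x) (j y) = j (x + y)"
  "hscale (push_hspace j) c (j x) = j (c *\<^sub>C x)"
  "hinner (push_hspace j) (j x) (j y) = cinner x y"
  "hdiff (push_hspace j) (j x) (j y) = j (x - y)"
  "hnorm (push_hspace j) (j x) = norm x"
  by (simp_all add: push_hspace_def hdiff_def hnorm_def inj inv_f_f scaleC_minus_one
      norm_eq_sqrt_inner inner_eq_Re_cinner)

lemma complex_hilbert_space_push: "complex_hilbert_space (push_hspace j)"
proof (unfold_locales, unfold push_hspace_simps(1))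
  fix X :: "nat \<Rightarrow> 'a"
  assume "range X \<subseteq> range j" and C: "\<forall>e>0. \<exists>N. \<forall>m\<ge>N. \<forall>n\<ge>N. hnorm (push_hspace j) (hdiff (push_hspace j) (X m) (X n)) < e"
  define Y where "Y = (\<lambda>n. inv j (X n))"
  have X: "X = (\<lambda>n. j (Y n))"
    using \<open>range X \<subseteq> range j\<close> by (simp add: Y_def fun_eq_iff f_inv_into_f range_subsetD)
  have "Cauchy Y"
    using C by (simp add: X push_hspace_simps Cauchy_def dist_norm)
  then obtain l where "Y \<longlonglongrightarrow> l"
    using Cauchy_convergent_iff convergent_def by blast
  then show "\<exists>l\<in>range j. (\<lambda>n. hnorm (push_hspace j) (hdiff (push_hspace j) (X n) l)) \<longlonglongrightarrow> 0"
    by (auto simp: X push_hspace_simps LIM_zero tendsto_norm_zero intro!: exI[of _ l])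
qed (auto simp: push_hspace_simps scaleC_add_right scaleC_add_left scaleC_scaleC scaleC_one
    scaleC_minus_one cinner_add_left cinner_scaleC_left add_ac
    simp flip: inner_eq_Re_cinner intro: cinner_commute
    dest: arg_cong[of _ _ Re])

lemma push_op_apply [simp]: "push_op j M (j x) = j (M x)"
  by (simp add: push_op_def inj inv_f_f)

lemma push_op_eqI: "(\<And>x. T (j x) = j (M x)) \<Longrightarrow> T \<in> extensional (range j) \<Longrightarrow> T = push_op j M"
  by (auto simp: push_op_def inj inv_f_f extensional_def fun_eq_iff restrict_def)

lemma push_op_inj: "push_op j M = push_op j N \<longleftrightarrow> M = N"
  by (metis push_op_apply inj injD ext)

lemma push_op_ops:
  "op_id (push_hspace j) = push_op j (\<lambda>x. x)"
  "op_zero (push_hspace j) = push_op j (\<lambda>x. 0)"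
  "op_add (push_hspace j) (push_op j M) (push_op j N) = push_op j (\<lambda>x. M x + N x)"
  "op_scale (push_hspace j) c (push_op j M) = push_op j (\<lambda>x. c *\<^sub>C M x)"
  "op_comp (push_hspace j) (push_op j M) (push_op j N) = push_op j (\<lambda>x. M (N x))"
  by (rule push_op_eqI; simp add: op_id_def op_zero_def op_add_def op_scale_def compose_def
      push_hspace_simps)+

lemma push_op_diff:
  "op_diff (push_hspace j) (push_op j M) (push_op j N) = push_op j (\<lambda>x. M x - N x)"
  by (simp add: op_diff_def push_op_ops scaleC_minus_one)

lemma push_op_bounded_iff [simp]:
  "push_op j M \<in> bounded_ops (push_hspace j) \<longleftrightarrow> M \<in> bounded_ops univ_hspace"
proof -
  have "push_op j M \<in> range j \<rightarrow>\<^sub>E range j"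
    by (auto simp: push_op_def)
  then show ?thesis
    by (simp add: bounded_ops_def push_hspace_simps inj_eq[OF inj])
qed

text \<open>Invertibility and \<open>fun_calc\<close> quantify over all bounded operators of the
  record, so each of these has to be pulled back to \<open>'b\<close>.\<close>

lemma bounded_op_eq_push_op:
  assumes "T \<in> bounded_ops (push_hspace j)"
  obtains M where "T = push_op j M"
proof -
  have T: "T \<in> range j \<rightarrow>\<^sub>E range j"
    using assms by (simp add: bounded_ops_def push_hspace_simps)
  then have "\<exists>y. T (j x) = j y" for x
    by (metis PiE_mem rangeE rangeI)
  then obtain M where "\<And>x. T (j x) = j (M x)"
    by metis
  then have "T = push_op j M"
    using T by (intro push_op_eqI) (auto simp: PiE_def)
  then show thesis
    by (rule that)
qed

lemma push_op_self_adjoint_iff [simp]: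
  "push_op j M \<in> self_adjoint_ops (push_hspace j) \<longleftrightarrow> M \<in> self_adjoint_ops univ_hspace"
  by (simp add: self_adjoint_ops_def push_hspace_simps)

lemma op_norm_push_op [simp]: "op_norm (push_hspace j) (push_op j M) = op_norm univ_hspace M"
proof -
  have "{x \<in> range j. hnorm (push_hspace j) x \<le> 1} = j ` {x. norm x \<le> 1}"
    by (auto simp: push_hspace_simps)
  then show ?thesis
    by (simp add: op_norm_def push_hspace_simps(1) image_image push_hspace_simps)
qed

lemma op_invertible_push_op [simp]:
  "op_invertible (push_hspace j) (push_op j M) \<longleftrightarrow> op_invertible univ_hspace M"
proof
  assume "op_invertible (push_hspace j) (push_op j M)"
  then obtain S where S: "S \<in> bounded_ops (push_hspace j)"
    "op_comp (push_hspace j) S (push_op j M) = op_id (push_hspace j)"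
    "op_comp (push_hspace j) (push_op j M) S = op_id (push_hspace j)"
    by (auto simp: op_invertible_def)
  obtain N where "S = push_op j N"
    using bounded_op_eq_push_op[OF S(1)] .
  with S show "op_invertible univ_hspace M"
    unfolding op_invertible_def by (intro bexI[of _ N]) (simp_all add: push_op_ops push_op_inj)
next
  assume "op_invertible univ_hspace M"
  then obtain N where "N \<in> bounded_ops univ_hspace" "(\<lambda>x. N (M x)) = (\<lambda>x. x)" "(\<lambda>x. M (N x)) = (\<lambda>x. x)"
    by (auto simp: op_invertible_def)
  then show "op_invertible (push_hspace j) (push_op j M)"
    unfolding op_invertible_def by (intro bexI[of _ "push_op j N"]) (simp_all add: push_op_ops)
qed

lemma op_spectrum_push_op [simp]:
  "op_spectrum (push_hspace j) (push_op j M) = op_spectrum univ_hspace M"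
  by (simp add: op_spectrum_def push_op_ops push_op_diff)

lemma real_spectrum_push_op [simp]:
  "real_spectrum (push_hspace j) (push_op j M) = real_spectrum univ_hspace M"
  by (simp add: real_spectrum_def)

lemma poly_op_push_op [simp]:
  "poly_op (push_hspace j) p (push_op j M) = push_op j (poly_op univ_hspace p M)"
proof -
  have "foldr (\<lambda>a S. op_add (push_hspace j) (op_scale (push_hspace j) (complex_of_real a)
        (op_id (push_hspace j))) (op_comp (push_hspace j) (push_op j M) S)) cs (op_zero (push_hspace j))
      = push_op j (foldr (\<lambda>a S. op_add univ_hspace (op_scale univ_hspace (complex_of_real a)
        (op_id univ_hspace)) (op_comp univ_hspace M S)) cs (op_zero univ_hspace))" for cs
    by (induction cs) (simp_all add: push_op_ops)
  then show ?thesis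
    by (simp only: poly_op_def fold_coeffs_def)
qed

lemma is_fun_calc_push_op:
  "is_fun_calc (push_hspace j) f (push_op j M) (push_op j S) \<longleftrightarrow> is_fun_calc univ_hspace f M S"
  by (simp add: is_fun_calc_def push_op_diff)

lemma fun_calc_push_op:
  assumes "M \<in> self_adjoint_ops univ_hspace" "continuous_on (real_spectrum univ_hspace M) f"
  shows "fun_calc (push_hspace j) f (push_op j M) = push_op j (fun_calc univ_hspace f M)"
  unfolding fun_calc_eq[of "push_hspace j"]
proof (rule the_equality)
  show "is_fun_calc (push_hspace j) f (push_op j M) (push_op j (fun_calc univ_hspace f M))"
    using is_fun_calc_fun_calc[OF assms] by (simp add: is_fun_calc_push_op)
next
  fix S assume S: "is_fun_calc (push_hspace j) f (push_op j M) S"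
  then obtain N where N: "S = push_op j N"
    using bounded_op_eq_push_op is_fun_calc_def by blast
  then have "N = fun_calc univ_hspace f M"
    using S ex1_is_fun_calc[OF assms] is_fun_calc_fun_calc[OF assms]
    by (auto simp: is_fun_calc_push_op)
  with N show "S = push_op j (fun_calc univ_hspace f M)"
    by simp
qed

lemma op_le_push_op [simp]:
  "op_le (push_hspace j) (push_op j M) (push_op j N) \<longleftrightarrow> op_le univ_hspace M N"
  by (simp add: op_le_def pos_semidef_def push_op_diff push_hspace_simps)

text \<open>Monotonicity given over \<open>'a\<close> can be tested on any Hilbert space
  \<open>'b\<close> that injects into \<open>'a\<close> as a set, whatever the dimensions.\<close>

lemma operator_monotone_transport:
  assumes "operator_monotone TYPE('a) J f"
    and A: "A \<in> self_adjoint_ops (univ_hspace :: 'b hspace)" "spectrum_in univ_hspace A J"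
      "continuous_on (real_spectrum univ_hspace A) f"
    and B: "B \<in> self_adjoint_ops (univ_hspace :: 'b hspace)" "spectrum_in univ_hspace B J"
      "continuous_on (real_spectrum univ_hspace B) f"
    and "op_le univ_hspace A B"
  shows "op_le univ_hspace (fun_calc univ_hspace f A) (fun_calc univ_hspace f B)"
proof -
  have "op_le (push_hspace j) (fun_calc (push_hspace j) f (push_op j A))
      (fun_calc (push_hspace j) f (push_op j B))"
    using assms complex_hilbert_space_push unfolding operator_monotone_def
    by (simp add: spectrum_in_def)
  then show ?thesis
    by (simp add: fun_calc_push_op A B)
qed

end

section \<open>Operators with two eigenvalues\<close>

text \<open>For a unit vector \<open>u\<close> this is a p + b (1 - p) with \<open>p\<close> the
  orthogonal projection onto the line of \<open>u\<close>: eigenvalue \<open>a\<close> at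
  \<open>u\<close>, eigenvalue \<open>b\<close> on the orthogonal complement.\<close>

definition two_eigenvalue_op :: "real \<Rightarrow> real \<Rightarrow> 'a \<Rightarrow> 'a \<Rightarrow> 'a::chilbert_space"
  where "two_eigenvalue_op a b u x = b *\<^sub>R x + (a - b) *\<^sub>R (cinner x u *\<^sub>C u)"

context
  fixes u :: "'a::chilbert_space"
  assumes u: "norm u = 1"
begin

lemma cinner_unit: "cinner u u = 1"
  using u cinner_commute[of u u]
  by (simp add: complex_eq_iff norm_eq_sqrt_inner flip: inner_eq_Re_cinner)

lemma inner_projection: "inner (cinner x u *\<^sub>C u) x = (cmod (cinner x u))\<^sup>2"
proof -
  have "cinner (cinner x u *\<^sub>C u) x = of_real ((cmod (cinner x u))\<^sup>2)"
    by (metis cinner_commute cinner_scaleC_left complex_norm_square)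
  then show ?thesis
    by (simp add: inner_eq_Re_cinner)
qed

lemma two_eigenvalue_op_form:
  "inner (two_eigenvalue_op a b u x) x = b * (norm x)\<^sup>2 + (a - b) * (cmod (cinner x u))\<^sup>2"
  by (simp add: two_eigenvalue_op_def inner_add_left inner_projection power2_norm_eq_inner)

lemma cmod_cinner_unit_le: "(cmod (cinner x u))\<^sup>2 \<le> (norm x)\<^sup>2"
proof -
  have "0 \<le> (norm (x - cinner x u *\<^sub>C u))\<^sup>2"
    by simp
  also have "\<dots> = (norm x)\<^sup>2 - 2 * (cmod (cinner x u))\<^sup>2 + (norm (cinner x u *\<^sub>C u))\<^sup>2"
    by (simp only: power2_norm_eq_inner inner_diff_left inner_diff_right inner_projection
        inner_commute[of x "cinner x u *\<^sub>C u"])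
  finally show ?thesis
    by (simp add: u)
qed

lemma two_eigenvalue_op_self_adjoint: "two_eigenvalue_op a b u \<in> self_adjoint_ops univ_hspace"
proof (rule self_adjointI)
  show hom: "two_eigenvalue_op a b u (c *\<^sub>C x) = c *\<^sub>C two_eigenvalue_op a b u x" for c x
    by (simp add: two_eigenvalue_op_def scaleC_add_right scaleC_scaleR cinner_scaleC_left scaleC_scaleC)
  have "norm (cinner x u *\<^sub>C u) \<le> norm x" for x
    using power2_le_imp_le[OF cmod_cinner_unit_le[of x]] u by simp
  then have "norm (two_eigenvalue_op a b u x) \<le> \<bar>b\<bar> * norm x + \<bar>a - b\<bar> * norm x" for x
    unfolding two_eigenvalue_op_def
    by (intro order.trans[OF norm_triangle_ineq] add_mono)
      (simp_all only: norm_scaleR order.refl mult_left_mono abs_ge_zero)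
  then have "norm (two_eigenvalue_op a b u x) \<le> norm x * (\<bar>b\<bar> + \<bar>a - b\<bar>)" for x
    by (simp add: algebra_simps)
  moreover have "two_eigenvalue_op a b u (x + y) = two_eigenvalue_op a b u x + two_eigenvalue_op a b u y"
    for x y
    by (simp add: two_eigenvalue_op_def cinner_add_left scaleC_add_left algebra_simps)
  moreover have "two_eigenvalue_op a b u (r *\<^sub>R x) = r *\<^sub>R two_eigenvalue_op a b u x" for r x
    using hom[of "complex_of_real r" x] by simp
  ultimately show "bounded_linear (two_eigenvalue_op a b u)"
    by (intro bounded_linear_intro)
  show "inner (two_eigenvalue_op a b u x) y = inner x (two_eigenvalue_op a b u y)" for x y
  proof -
    have "inner (cinner x u *\<^sub>C u) y = inner x (cinner y u *\<^sub>C u)"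
      unfolding inner_eq_Re_cinner cinner_scaleC_left cinner_scaleC_right
      by (subst cinner_commute[of u y]) (simp add: mult.commute)
    then show ?thesis
      by (simp add: two_eigenvalue_op_def inner_add_left inner_add_right)
  qed
qed

lemma two_eigenvalue_op_comp:
  "two_eigenvalue_op a b u (two_eigenvalue_op a' b' u x) = two_eigenvalue_op (a * a') (b * b') u x"
proof -
  have "cinner (two_eigenvalue_op a' b' u x) u = of_real a' * cinner x u"
    by (simp add: two_eigenvalue_op_def cinner_add_left cinner_scaleC_left scaleR_scaleC
        cinner_unit algebra_simps del: scaleC_of_real)
  then show ?thesis
    by (simp add: two_eigenvalue_op_def scaleR_add_right algebra_simps flip: scaleC_scaleC)
qed

lemma real_spectrum_two_eigenvalue_op:
  "real_spectrum univ_hspace (two_eigenvalue_op a b u) \<subseteq> {a, b}"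
proof
  fix t assume t: "t \<in> real_spectrum univ_hspace (two_eigenvalue_op a b u)"
  show "t \<in> {a, b}"
  proof (rule ccontr)
    assume "t \<notin> {a, b}"
    then have "two_eigenvalue_op (a - t) (b - t) u (two_eigenvalue_op (1 / (a - t)) (1 / (b - t)) u x) = x"
      "two_eigenvalue_op (1 / (a - t)) (1 / (b - t)) u (two_eigenvalue_op (a - t) (b - t) u x) = x" for x
      unfolding two_eigenvalue_op_comp by (simp_all add: two_eigenvalue_op_def)
    moreover have "two_eigenvalue_op a b u x - t *\<^sub>R x = two_eigenvalue_op (a - t) (b - t) u x" for x
      by (simp add: two_eigenvalue_op_def algebra_simps)
    ultimately have "op_invertible univ_hspace (\<lambda>x. two_eigenvalue_op a b u x - t *\<^sub>R x)"
      unfolding op_invertible_def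
      by (intro bexI[of _ "two_eigenvalue_op (1 / (a - t)) (1 / (b - t)) u"])
        (simp_all add: two_eigenvalue_op_self_adjoint self_adjoint_bounded_op)
    with t show False
      by (simp add: real_spectrum_iff)
  qed
qed

text \<open>Every function is continuous on a finite set. Functional calculus for \<open>f\<close>
  is thus available here before anything is known about the continuity of \<open>f\<close>.\<close>

lemma continuous_on_two_eigenvalue_spectrum:
  "continuous_on (real_spectrum univ_hspace (two_eigenvalue_op a b u)) f"
  by (rule continuous_on_finite[OF finite_subset[OF real_spectrum_two_eigenvalue_op]]) simp

text \<open>\<open>x\<close> is split into its component along \<open>u\<close> and the orthogonal
  rest, which are eigenvectors for \<open>a\<close> and \<open>b\<close>.\<close>

lemma fun_calc_two_eigenvalue_op:
  "fun_calc univ_hspace f (two_eigenvalue_op a b u) = two_eigenvalue_op (f a) (f b) u"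
proof
  fix x
  let ?D = "two_eigenvalue_op a b u" and ?p = "cinner x u *\<^sub>C u"
  note D = two_eigenvalue_op_self_adjoint[of a b]
  note c = continuous_on_two_eigenvalue_spectrum[of a b f]
  have "?D ?p = a *\<^sub>R ?p"
    by (simp add: two_eigenvalue_op_def cinner_scaleC_left cinner_unit algebra_simps)
  moreover have "cinner (x - ?p) u = 0"
    using cinner_add_left[of "x - ?p" ?p u] by (simp add: cinner_scaleC_left cinner_unit)
  then have "?D (x - ?p) = b *\<^sub>R (x - ?p)"
    by (simp add: two_eigenvalue_op_def)
       (metis scaleR_scaleC scaleR_zero_left of_real_0)
  ultimately have "fun_calc univ_hspace f ?D (?p + (x - ?p)) = f a *\<^sub>R ?p + f b *\<^sub>R (x - ?p)"
    unfolding self_adjointD(4)[OF fun_calc_self_adjoint[OF D c]]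
    by (simp only: fun_calc_eigenvector[OF D c])
  then show "fun_calc univ_hspace f ?D x = two_eigenvalue_op (f a) (f b) u x"
    by (simp add: two_eigenvalue_op_def algebra_simps)
qed

lemma spectrum_in_two_eigenvalue_op:
  assumes "a > 0" "b > 0"
  shows "spectrum_in univ_hspace (two_eigenvalue_op a b u) {0<..}"
proof (rule spectrum_in_positiveI[OF two_eigenvalue_op_self_adjoint])
  show "min a b > 0"
    using assms by simp
  fix x
  have "0 \<le> (b - min a b) * ((norm x)\<^sup>2 - (cmod (cinner x u))\<^sup>2) + (a - min a b) * (cmod (cinner x u))\<^sup>2"
    using cmod_cinner_unit_le by (intro add_nonneg_nonneg mult_nonneg_nonneg) auto
  then show "min a b * (norm x)\<^sup>2 \<le> inner (two_eigenvalue_op a b u x) x"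
    by (simp add: two_eigenvalue_op_form algebra_simps)
qed

end

section \<open>Two-by-two matrices over the complex numbers\<close>

instantiation prod :: (chilbert_space, chilbert_space) chilbert_space
begin

definition scaleC_prod :: "complex \<Rightarrow> 'a \<times> 'b \<Rightarrow> 'a \<times> 'b"
  where "scaleC_prod c x = (c *\<^sub>C fst x, c *\<^sub>C snd x)"

definition cinner_prod :: "'a \<times> 'b \<Rightarrow> 'a \<times> 'b \<Rightarrow> complex"
  where "cinner_prod x y = cinner (fst x) (fst y) + cinner (snd x) (snd y)"

instance
proof
  fix x y :: "'a \<times> 'b"
  show "cinner x y = cnj (cinner y x)"
    using cinner_commute[of "fst x" "fst y"] cinner_commute[of "snd x" "snd y"]
    by (simp add: cinner_prod_def)
qed (simp_all add: scaleC_prod_def cinner_prod_def prod_eq_iff scaleC_add_right scaleC_add_left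
    scaleC_scaleC cinner_add_left cinner_scaleC_left inner_prod_def inner_eq_Re_cinner algebra_simps)

end

text \<open>Pure cardinality: the multiples of \<open>v\<close> form a copy of the complex numbers,
  so \<open>'a\<close> is infinite and \<open>'a \<times> 'a\<close> is equipotent to
  \<open>'a\<close>. A linear embedding would not exist in dimension one.\<close>

lemma exists_inj_complex_prod:
  assumes "(v :: 'a::chilbert_space) \<noteq> 0"
  shows "\<exists>j :: complex \<times> complex \<Rightarrow> 'a. inj j"
proof -
  have i: "inj (\<lambda>c. c *\<^sub>C v)"
  proof (rule injI)
    fix c d assume "c *\<^sub>C v = d *\<^sub>C v"
    then have "norm ((c - d) *\<^sub>C v) = 0"
      using scaleC_add_left[of "c - d" d v] by simp
    with assms show "c = d"
      by simp
  qed
  then have "infinite (UNIV :: 'a set)"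
    using infinite_UNIV_char_0[where ?'a = complex] finite_imageD[of "\<lambda>c. c *\<^sub>C v" UNIV]
    by (metis finite_subset subset_UNIV)
  then obtain h :: "'a \<times> 'a \<Rightarrow> 'a" where "bij_betw h (UNIV \<times> UNIV) UNIV"
    using card_of_Times_same_infinite card_of_ordIso by blast
  then have h: "inj h"
    by (simp add: bij_betw_def)
  have "inj (\<lambda>p. h (fst p *\<^sub>C v, snd p *\<^sub>C v))"
  proof (rule injI)
    fix p q :: "complex \<times> complex"
    assume "h (fst p *\<^sub>C v, snd p *\<^sub>C v) = h (fst q *\<^sub>C v, snd q *\<^sub>C v)"
    then have "fst p *\<^sub>C v = fst q *\<^sub>C v" "snd p *\<^sub>C v = snd q *\<^sub>C v"
      using injD[OF h] by blast+
    then show "p = q"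
      using injD[OF i] by (intro prod_eqI) blast+
  qed
  then show ?thesis
    by blast
qed

lemma operator_monotone_two_by_two:
  fixes u u' :: "complex \<times> complex" and v :: "'a::chilbert_space"
  assumes f: "operator_monotone TYPE('a) {0<..} f" and nz: "v \<noteq> 0"
    and u: "norm u = 1" "norm u' = 1" and pos: "a > 0" "b > 0" "a' > 0" "b' > 0"
    and le: "\<And>x. inner (two_eigenvalue_op a b u x) x \<le> inner (two_eigenvalue_op a' b' u' x) x"
  shows "inner (two_eigenvalue_op (f a) (f b) u x) x \<le> inner (two_eigenvalue_op (f a') (f b') u' x) x"
proof -
  note sa = two_eigenvalue_op_self_adjoint[OF u(1)] two_eigenvalue_op_self_adjoint[OF u(2)]
  obtain j :: "complex \<times> complex \<Rightarrow> 'a" where j: "inj j"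
    using exists_inj_complex_prod[OF nz] by blast
  have "op_le univ_hspace (two_eigenvalue_op a b u) (two_eigenvalue_op a' b' u')"
    using le op_le_iff[OF sa] by blast
  then have "op_le univ_hspace (fun_calc univ_hspace f (two_eigenvalue_op a b u))
      (fun_calc univ_hspace f (two_eigenvalue_op a' b' u'))"
    by (rule operator_monotone_transport[OF j f
          sa(1) spectrum_in_two_eigenvalue_op[OF u(1) pos(1,2)]
          continuous_on_two_eigenvalue_spectrum[OF u(1)]
          sa(2) spectrum_in_two_eigenvalue_op[OF u(2) pos(3,4)]
          continuous_on_two_eigenvalue_spectrum[OF u(2)]])
  then show ?thesis
    unfolding fun_calc_two_eigenvalue_op[OF u(1)] fun_calc_two_eigenvalue_op[OF u(2)]
    using op_le_iff[OF sa] by blast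
qed

text \<open>Completing the square: |k x - s y|^2 \<ge> 0, divided by \<open>k\<close>. It absorbs an
  off-diagonal entry \<open>s\<close>, at the cost of \<open>k\<close> in the first diagonal entry
  and s^2/k in the second.\<close>

lemma cross_term_bound:
  fixes x y :: "'a::real_inner"
  assumes "k > 0"
  shows "2 * s * inner x y \<le> k * (norm x)\<^sup>2 + s\<^sup>2 / k * (norm y)\<^sup>2"
proof -
  have "0 \<le> (norm (k *\<^sub>R x - s *\<^sub>R y))\<^sup>2"
    by simp
  also have "\<dots> = k\<^sup>2 * (norm x)\<^sup>2 + s\<^sup>2 * (norm y)\<^sup>2 - k * (2 * s * inner x y)"
    by (simp only: power2_norm_eq_inner inner_diff_left inner_diff_right inner_scaleR_left
        inner_scaleR_right inner_commute[of y x] power2_eq_square[of k] power2_eq_square[of s])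
      (simp add: algebra_simps)
  also have "\<dots> = k * (k * (norm x)\<^sup>2 + s\<^sup>2 / k * (norm y)\<^sup>2 - 2 * s * inner x y)"
    using assms by (simp add: right_diff_distrib distrib_left power2_eq_square[of k])
  finally show ?thesis
    using assms by (simp add: zero_le_mult_iff)
qed

text \<open>The eigenvector for \<open>a\<close> is (sqrt t, sqrt (1 - t)), so the (1,1) entry is
  the average of \<open>a\<close> and \<open>b\<close> with weights t and 1 - t; the off-diagonal
  entry is sqrt (t (1 - t)) (a - b).\<close>

lemma two_eigenvalue_op_rotated_form:
  fixes x y :: complex
  assumes t: "0 < t" "t < 1"
  shows "inner (two_eigenvalue_op a b (of_real (sqrt t), of_real (sqrt (1 - t))) (x, y)) (x, y) =
    (t * a + (1 - t) * b) * (norm x)\<^sup>2 + ((1 - t) * a + t * b) * (norm y)\<^sup>2 +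
    2 * (sqrt (t * (1 - t)) * (a - b)) * inner x y"
    "norm (complex_of_real (sqrt t), complex_of_real (sqrt (1 - t))) = 1"
proof -
  show u: "norm (complex_of_real (sqrt t), complex_of_real (sqrt (1 - t))) = 1"
    using t by (simp add: norm_Pair)
  have "cinner (x, y) (complex_of_real (sqrt t), complex_of_real (sqrt (1 - t))) =
      sqrt t *\<^sub>R x + sqrt (1 - t) *\<^sub>R y"
    by (simp add: cinner_prod_def cinner_complex_def scaleR_conv_of_real)
  moreover have "(norm (p *\<^sub>R x + q *\<^sub>R y))\<^sup>2 =
      p\<^sup>2 * (norm x)\<^sup>2 + q\<^sup>2 * (norm y)\<^sup>2 + 2 * (p * q) * inner x y" for p q
    by (simp only: power2_norm_eq_inner inner_add_left inner_add_right inner_scaleR_left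
        inner_scaleR_right inner_commute[of y x] power2_eq_square[of p] power2_eq_square[of q])
      (simp add: algebra_simps)
  from this[of "sqrt t" "sqrt (1 - t)"]
  have "(norm (sqrt t *\<^sub>R x + sqrt (1 - t) *\<^sub>R y))\<^sup>2 =
      t * (norm x)\<^sup>2 + (1 - t) * (norm y)\<^sup>2 + 2 * sqrt (t * (1 - t)) * inner x y"
    using t by (simp add: real_sqrt_mult)
  moreover have "(norm (x, y))\<^sup>2 = (norm x)\<^sup>2 + (norm y)\<^sup>2"
    by (simp add: norm_Pair)
  ultimately show "inner (two_eigenvalue_op a b (of_real (sqrt t), of_real (sqrt (1 - t))) (x, y)) (x, y) =
    (t * a + (1 - t) * b) * (norm x)\<^sup>2 + ((1 - t) * a + t * b) * (norm y)\<^sup>2 +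
    2 * (sqrt (t * (1 - t)) * (a - b)) * inner x y"
    unfolding two_eigenvalue_op_form[OF u] by (simp only:) (simp add: algebra_simps)
qed

lemma two_eigenvalue_op_diagonal_form:
  fixes x y :: complex
  shows "inner (two_eigenvalue_op a b (1, 0) (x, y)) (x, y) = a * (norm x)\<^sup>2 + b * (norm y)\<^sup>2"
    "norm (1 :: complex, 0 :: complex) = 1"
proof -
  show e: "norm (1 :: complex, 0 :: complex) = 1"
    by (simp add: norm_Pair)
  show "inner (two_eigenvalue_op a b (1, 0) (x, y)) (x, y) = a * (norm x)\<^sup>2 + b * (norm y)\<^sup>2"
    unfolding two_eigenvalue_op_form[OF e]
    by (simp add: cinner_prod_def cinner_complex_def norm_Pair algebra_simps)
qed

text \<open>The gap \<open>k\<close> between \<open>m\<close> and the (1,1) entry has to be strictly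
  positive to absorb the off-diagonal entry; any size of \<open>M\<close> will do, since the
  conclusion only reads off the value at (1, 0). Concavity without a gap must wait for
  continuity.\<close>

lemma operator_monotone_concave_below:
  fixes v :: "'a::chilbert_space"
  assumes f: "operator_monotone TYPE('a) {0<..} f" and nz: "v \<noteq> 0"
    and ab: "a > 0" "b > 0" and t: "0 < t" "t < 1" and m: "t * a + (1 - t) * b < m"
  shows "t * f a + (1 - t) * f b \<le> f m"
proof -
  define s where "s = sqrt (t * (1 - t)) * (a - b)"
  define k where "k = m - (t * a + (1 - t) * b)"
  define M where "M = (1 - t) * a + t * b + s\<^sup>2 / k"
  note u = two_eigenvalue_op_rotated_form[OF t] and e = two_eigenvalue_op_diagonal_form
  have k: "k > 0"
    using m by (simp add: k_def)
  have "(1 - t) * a + t * b > 0" "t * a + (1 - t) * b > 0"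
    using ab t by (simp_all add: add_pos_pos)
  then have "M > 0" "m > 0"
    using k m by (auto simp: M_def intro: add_pos_nonneg)
  have le: "inner (two_eigenvalue_op a b (of_real (sqrt t), of_real (sqrt (1 - t))) z) z
      \<le> inner (two_eigenvalue_op m M (1, 0) z) z" for z :: "complex \<times> complex"
    using cross_term_bound[OF k, of s "fst z" "snd z"]
    by (cases z) (simp only: u e s_def[symmetric], simp add: k_def M_def algebra_simps)
  show ?thesis
    using operator_monotone_two_by_two[OF f nz u(2) e(2) ab \<open>m > 0\<close> \<open>M > 0\<close> le, of "(1, 0)"]
    by (simp only: u e) simp
qed

lemma operator_monotone_harmonic_above:
  fixes v :: "'a::chilbert_space"
  assumes f: "operator_monotone TYPE('a) {0<..} f" and nz: "v \<noteq> 0"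
    and ab: "a > 0" "b > 0" and t: "0 < t" "t < 1"
    and m: "0 < m" "m * ((1 - t) * a + t * b) < a * b"
  shows "f m \<le> t * f a + (1 - t) * f b"
proof -
  define s where "s = sqrt (t * (1 - t)) * (a - b)"
  define k where "k = (t * a + (1 - t) * b) - m"
  define N where "N = (1 - t) * a + t * b"
  define M where "M = N - s\<^sup>2 / k"
  note u = two_eigenvalue_op_rotated_form[OF t] and e = two_eigenvalue_op_diagonal_form
  have s2: "s\<^sup>2 = t * (1 - t) * (a - b)\<^sup>2"
    using t by (simp add: s_def power_mult_distrib)
  have N: "N > 0"
    using ab t by (simp add: N_def add_pos_pos)
  \<comment> \<open>The matrix has determinant ab, so N (t a + (1 - t) b) - s^2 = ab. Hence m N < ab
    is the same as s^2 < N k, that is, positivity of \<open>M\<close>.\<close>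
  have kN: "s\<^sup>2 < N * k"
    using m(2) unfolding s2 k_def N_def by (simp add: algebra_simps power2_eq_square)
  have "0 \<le> s\<^sup>2"
    by simp
  with kN have "0 < N * k"
    by linarith
  then have k: "k > 0"
    using N by (simp add: zero_less_mult_iff)
  have M: "M > 0"
    using k kN by (simp add: M_def field_simps)
  have le: "inner (two_eigenvalue_op m M (1, 0) z) z \<le>
      inner (two_eigenvalue_op a b (of_real (sqrt t), of_real (sqrt (1 - t))) z) z"
    for z :: "complex \<times> complex"
    using cross_term_bound[OF k, of "- s" "fst z" "snd z"]
    by (cases z) (simp only: u e s_def[symmetric], simp add: k_def M_def N_def algebra_simps)
  show ?thesis
    using operator_monotone_two_by_two[OF f nz e(2) u(2) m(1) M ab le, of "(1, 0)"]
    by (simp only: u e) simp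
qed

section \<open>Scalar properties of operator monotone functions\<close>

context
  fixes f :: "real \<Rightarrow> real"
  assumes pos: "\<And>x. x > 0 \<Longrightarrow> f x > 0" and one: "f 1 = 1"
    and below: "\<And>a b t m. \<lbrakk>a > 0; b > 0; 0 < t; t < 1; t * a + (1 - t) * b < m\<rbrakk>
      \<Longrightarrow> t * f a + (1 - t) * f b \<le> f m"
    and above: "\<And>a b t m. \<lbrakk>a > 0; b > 0; 0 < t; t < 1; 0 < m; m * ((1 - t) * a + t * b) < a * b\<rbrakk>
      \<Longrightarrow> f m \<le> t * f a + (1 - t) * f b"
begin

lemma pinched_mono:
  assumes "0 < x" "x \<le> y"
  shows "f x \<le> f y"
  using below[of x x "1 / 2" y] assms by (cases "x = y") auto

text \<open>Positivity and the gapped concavity exclude jumps. For points b < x0 < a close to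
  \<open>x0\<close>, a combination of \<open>a\<close> and x0/2 with weight \<open>t\<close> on
  \<open>a\<close> lies below \<open>b\<close>; dropping the positive term at x0/2 leaves t f(a)
  \<le> f(b), with \<open>t\<close> as near to 1 as desired.\<close>

lemma pinched_continuous_on: "continuous_on {0<..} f"
proof -
  have "\<exists>d>0. \<forall>x. dist x x0 < d \<longrightarrow> dist (f x) (f x0) < e" if x0: "x0 > 0" and e: "e > 0" for x0 e
  proof -
    \<comment> \<open>1 - t \<le> 1/2 yields f(a) \<le> 2 f(x0); then 1 - t \<le> e/(4 f(x0)) bounds
      f(a) - f(b) by e/2.\<close>
    define t where "t = 1 - min (1 / 2) (e / (4 * f x0))"
    have t: "1 / 2 \<le> t" "t < 1" "1 - t \<le> e / (4 * f x0)"
      using e pos[OF x0] by (auto simp: t_def)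
    \<comment> \<open>\<open>a\<close> exceeds \<open>x0\<close> by the fraction (1 - t)/4 only,
      less than what x0/2 with weight 1 - t takes away, so that the combination \<open>c\<close>
      falls below \<open>x0\<close>.\<close>
    define a where "a = x0 * (1 + (1 - t) / 4)"
    define c where "c = t * a + (1 - t) * (x0 / 2)"
    define b where "b = (c + x0) / 2"
    have "x0 - c = x0 * ((1 - t) * (1 / 2 - t / 4))"
      by (simp add: a_def c_def field_simps)
    also have "\<dots> > 0"
      using x0 t by (intro mult_pos_pos) auto
    finally have m: "c < x0"
      by simp
    have a: "x0 < a"
      using x0 t by (simp add: a_def)
    have b: "c < b" "b < x0"
      using m by (simp_all add: b_def)
    have "0 < c"
      unfolding c_def using x0 t a by (intro add_pos_pos mult_pos_pos) auto
    then have b0: "0 < b"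
      using b(1) by linarith
    have "t * f a + (1 - t) * f (x0 / 2) \<le> f b"
      using x0 t a b unfolding c_def by (intro below) auto
    moreover have "0 \<le> (1 - t) * f (x0 / 2)"
      using pos[of "x0 / 2"] x0 t by simp
    ultimately have ab: "t * f a \<le> f b"
      by linarith
    have gap: "f a - f b < e"
    proof -
      have "f b \<le> f x0"
        using b b0 by (intro pinched_mono) auto
      moreover have "f a * (1 / 2) \<le> f a * t"
        using t pos[of a] a x0 by (intro mult_left_mono) auto
      ultimately have "f a \<le> 2 * f x0"
        using ab by (simp add: mult.commute)
      have "f a - f b \<le> (1 - t) * f a"
        using ab by (simp add: algebra_simps)
      also have "\<dots> \<le> e / (4 * f x0) * (2 * f x0)"
        using t \<open>f a \<le> 2 * f x0\<close> pos[of a] pos[OF x0] a x0 e by (intro mult_mono) auto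
      also have "\<dots> < e"
        using e pos[OF x0] by simp
      finally show ?thesis .
    qed
    have "dist (f x) (f x0) < e" if "dist x x0 < min (x0 - b) (a - x0)" for x
    proof -
      have "b < x" "x < a"
        using that by (auto simp: dist_real_def)
      then have "f b \<le> f x" "f x \<le> f a" "f b \<le> f x0" "f x0 \<le> f a"
        using a b b0 x0 by (auto intro!: pinched_mono)
      then show ?thesis
        using gap by (simp add: dist_real_def)
    qed
    then show ?thesis
      using a b by (intro exI[of _ "min (x0 - b) (a - x0)"]) auto
  qed
  then have "\<forall>x0\<in>{0<..}. isCont f x0"
    by (auto simp: continuous_at_eps_delta dist_commute)
  then show ?thesis
    by (simp add: continuous_at_imp_continuous_on)
qed

text \<open>Continuity closes the gap in \<open>below\<close>: \<open>m\<close> decreases to the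
  convex combination.\<close>

lemma pinched_concave:
  assumes "a > 0" "b > 0" "0 < t" "t < 1"
  shows "t * f a + (1 - t) * f b \<le> f (t * a + (1 - t) * b)"
proof -
  have "t * a + (1 - t) * b > 0"
    using assms by (simp add: add_pos_pos)
  then have "isCont f (t * a + (1 - t) * b)"
    using pinched_continuous_on continuous_on_interior[of "{0<..}" f]
    by (simp add: interior_open)
  then have "(f \<longlongrightarrow> f (t * a + (1 - t) * b)) (at_right (t * a + (1 - t) * b))"
    by (simp add: continuous_at filterlim_at_split)
  moreover have "\<forall>\<^sub>F m in at_right (t * a + (1 - t) * b). t * f a + (1 - t) * f b \<le> f m"
    using below[OF assms] by (auto simp: eventually_at_right_less intro: eventually_mono[OF eventually_at_right_less])
  ultimately show ?thesis
    by (rule tendsto_lowerbound) simp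
qed

text \<open>The distance \<open>g\<close> from \<open>f\<close> up to a supporting line at 1 is
  nonnegative on both sides of 1, so an O(h^2) bound for g(h) + g(-h) bounds each term.
  Differentiability at 1 then follows from the quadratic estimate.\<close>

lemma pinched_expansion:
  obtains \<alpha> C where "0 \<le> \<alpha>" "0 \<le> C" "\<And>x. x > 0 \<Longrightarrow> f x \<le> 1 + \<alpha> * (x - 1)"
    "\<And>x. \<bar>x - 1\<bar> \<le> 1 / 4 \<Longrightarrow> 1 + \<alpha> * (x - 1) - C * (x - 1)\<^sup>2 \<le> f x"
    "(f has_real_derivative \<alpha>) (at 1)"
proof -
  have conv: "convex_on {0<..} (\<lambda>x. - f x)"
  proof (rule convex_onI)
    fix t x y :: real
    assume "0 < t" "t < 1" "x \<in> {0<..}" "y \<in> {0<..}"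
    then show "- f ((1 - t) *\<^sub>R x + t *\<^sub>R y) \<le> (1 - t) * - f x + t * - f y"
      using pinched_concave[of y x t] by (simp add: add.commute)
  qed simp
  \<comment> \<open>\<open>I\<close> is the right derivative of the convex function -f at 1, so
    \<alpha> is the right derivative of \<open>f\<close>.\<close>
  define I where "I = Inf ((\<lambda>t. (- f 1 - - f t) / (1 - t)) ` ({1<..} \<inter> {0<..}))"
  define \<alpha> where "\<alpha> = - I"
  have up: "f x \<le> 1 + \<alpha> * (x - 1)" if "x > 0" for x
    using convex_le_Inf_differential[OF conv, of 1 x] that one
    by (simp add: interior_open I_def \<alpha>_def)
  have "\<alpha> \<ge> 0"
    using up[of 2] pinched_mono[of 1 2] one by simp
  define g where "g h = 1 + \<alpha> * h - f (1 + h)" for h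
  \<comment> \<open>From g(h) + g(-h) \<le> 2 g(-2h^2) + 4 \<alpha> h^2 and g(-2h^2) \<le> 4h^2
    g(-1/2).\<close>
  define C where "C = 8 * g (- 1 / 2) + 4 * \<alpha>"
  have g0: "g h \<ge> 0" if "h > - 1" for h
    using up[of "1 + h"] that by (simp add: g_def)
  have C: "C \<ge> 0"
    using g0[of "- 1 / 2"] \<open>\<alpha> \<ge> 0\<close> by (simp add: C_def)
  have quad: "g h + g (- h) \<le> C * h\<^sup>2" if h: "0 < h" "h \<le> 1 / 4" for h
  proof -
    have h2: "h\<^sup>2 \<le> 1 / 16" "h\<^sup>2 > 0"
      using power_mono[of h "1 / 4" 2] h by (simp_all add: power2_eq_square)
    \<comment> \<open>The harmonic mean of 1 + h and 1 - h is 1 - h^2; the point 1 - 2h^2 lies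
      strictly below it, as \<open>above\<close> requires.\<close>
    have "f (1 - 2 * h\<^sup>2) \<le> 1 / 2 * f (1 + h) + (1 - 1 / 2) * f (1 - h)"
    proof (rule above)
      show "(1 - 2 * h\<^sup>2) * ((1 - 1 / 2) * (1 + h) + 1 / 2 * (1 - h)) < (1 + h) * (1 - h)"
        using h2 by (simp add: field_simps power2_eq_square)
    qed (use h h2 in auto)
    then have "g h + g (- h) \<le> 2 * g (- 2 * h\<^sup>2) + 4 * \<alpha> * h\<^sup>2"
      by (simp add: g_def)
    moreover have "g (- 2 * h\<^sup>2) \<le> 4 * h\<^sup>2 * g (- 1 / 2)"
    proof -
      \<comment> \<open>Convexity of \<open>g\<close> with g(0) = 0, on the segment from 0 to -1/2,
        at the fraction 4h^2.\<close>
      have "4 * h\<^sup>2 * f (1 / 2) + (1 - 4 * h\<^sup>2) * f 1 \<le> f (4 * h\<^sup>2 * (1 / 2) + (1 - 4 * h\<^sup>2) * 1)"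
        using h2 by (intro pinched_concave) auto
      then show ?thesis
        by (simp add: g_def one algebra_simps)
    qed
    ultimately show ?thesis
      by (simp add: C_def algebra_simps)
  qed
  have gb: "g h \<le> C * h\<^sup>2" if "\<bar>h\<bar> \<le> 1 / 4" for h
  proof -
    consider "h = 0" | "h > 0" | "h < 0"
      by linarith
    then show ?thesis
    proof cases
      case 1
      then show ?thesis
        by (simp add: g_def one)
    next
      case 2
      then show ?thesis
        using quad[of h] g0[of "- h"] that by simp
    next
      case 3
      then show ?thesis
        using quad[of "- h"] g0[of "- h"] that by simp
    qed
  qed
  have low: "1 + \<alpha> * (x - 1) - C * (x - 1)\<^sup>2 \<le> f x" if "\<bar>x - 1\<bar> \<le> 1 / 4" for x
    using gb[OF that] by (simp add: g_def)
  have "((\<lambda>h. (f (1 + h) - f 1) / h) \<longlongrightarrow> \<alpha>) (at 0)"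
  proof (rule LIM_zero_cancel, rule Lim_null_comparison)
    show "((\<lambda>h::real. C * \<bar>h\<bar>) \<longlongrightarrow> 0) (at 0)"
      by (auto intro!: tendsto_eq_intros)
    have "norm ((f (1 + h) - f 1) / h - \<alpha>) \<le> C * \<bar>h\<bar>" if "h \<noteq> 0" "dist h 0 < 1 / 4" for h
    proof -
      have "(f (1 + h) - f 1) / h - \<alpha> = - (g h / h)"
        using that by (simp add: g_def one field_simps)
      moreover have "\<bar>g h\<bar> \<le> C * \<bar>h\<bar> * \<bar>h\<bar>"
        using gb[of h] g0[of h] that by (simp add: dist_real_def power2_eq_square)
      ultimately show ?thesis
        using that by (simp add: pos_divide_le_eq)
    qed
    then show "\<forall>\<^sub>F h in at 0. norm ((f (1 + h) - f 1) / h - \<alpha>) \<le> C * \<bar>h\<bar>"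
      unfolding eventually_at by (intro exI[of _ "1 / 4"]) auto
  qed
  then have "(f has_real_derivative \<alpha>) (at 1)"
    by (simp add: DERIV_def)
  then show thesis
    using that \<open>\<alpha> \<ge> 0\<close> C up low by blast
qed

text \<open>Concavity and monotonicity would still admit min(x, 1); the harmonic inequality
  \<open>above\<close> excludes it. For q < 1, with weight r = q/2 on \<open>q\<close> and 1 - r on
  3, the weighted harmonic mean of 3 and \<open>q\<close> exceeds 1, so 1 \<le> (1 - r) f(3) + r
  f(q) and f(3) \<le> 1 forces f(q) \<ge> 1.\<close>

lemma pinched_constant:
  assumes "\<And>x. x > 0 \<Longrightarrow> f x \<le> 1"
  shows "f constant_on {0<..}"
proof -
  have "f q = 1" if q: "q > 0" for q
  proof (cases "q \<ge> 1")
    case True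
    then show ?thesis
      using pinched_mono[of 1 q] assms[of q] one by simp
  next
    case False
    define r where "r = q / 2"
    have r: "q = 2 * r" "0 < r" "r < 1"
      using q False by (simp_all add: r_def)
    have "f 1 \<le> (1 - r) * f 3 + (1 - (1 - r)) * f q"
    proof (rule above)
      have "0 < r * r"
        using r by simp
      then show "1 * ((1 - (1 - r)) * 3 + (1 - r) * q) < 3 * q"
        unfolding r(1) by (simp add: algebra_simps) (use r in linarith)
    qed (use q r in simp_all)
    also have "\<dots> \<le> (1 - r) * 1 + (1 - (1 - r)) * f q"
      using assms[of 3] r by (intro add_mono mult_left_mono) auto
    finally have "r * 1 \<le> r * f q"
      using one by simp
    then have "1 \<le> f q"
      using r by simp
    then show ?thesis
      using assms[OF q] by simp
  qed
  then show ?thesis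
    by (auto simp: constant_on_def)
qed

end

section \<open>Operator means\<close>

lemma OM1_expansion:
  fixes v :: "'a::chilbert_space"
  assumes f: "f \<in> OM1 TYPE('a)" and nz: "v \<noteq> 0"
  obtains \<alpha> C where "0 \<le> \<alpha>" "0 \<le> C" "\<And>x. x > 0 \<Longrightarrow> f x \<le> 1 + \<alpha> * (x - 1)"
    "\<And>x. \<bar>x - 1\<bar> \<le> 1 / 4 \<Longrightarrow> 1 + \<alpha> * (x - 1) - C * (x - 1)\<^sup>2 \<le> f x"
    "(f has_real_derivative \<alpha>) (at 1)" "continuous_on {0<..} f"
    "\<And>x y. 0 < x \<Longrightarrow> x \<le> y \<Longrightarrow> f x \<le> f y" "\<not> f constant_on {0<..} \<Longrightarrow> 0 < \<alpha>"
proof -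
  have pos: "\<And>x. x > 0 \<Longrightarrow> f x > 0" and om: "operator_monotone TYPE('a) {0<..} f" and one: "f 1 = 1"
    using f by (auto simp: OM1_def)
  note pinched = pos one operator_monotone_concave_below[OF om nz] operator_monotone_harmonic_above[OF om nz]
  obtain \<alpha> C where *: "0 \<le> \<alpha>" "0 \<le> C" "\<And>x. x > 0 \<Longrightarrow> f x \<le> 1 + \<alpha> * (x - 1)"
    "\<And>x. \<bar>x - 1\<bar> \<le> 1 / 4 \<Longrightarrow> 1 + \<alpha> * (x - 1) - C * (x - 1)\<^sup>2 \<le> f x"
    "(f has_real_derivative \<alpha>) (at 1)"
    using pinched_expansion[of f, OF pinched] by blast
  have "f constant_on {0<..}" if "\<alpha> = 0"
    using *(3) that by (intro pinched_constant[of f, OF pinched]) auto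
  then have "\<not> f constant_on {0<..} \<Longrightarrow> 0 < \<alpha>"
    using *(1) by (cases "\<alpha> = 0") auto
  with * show thesis
    using that[of \<alpha> C] pinched_continuous_on[of f, OF pinched] pinched_mono[of f, OF pinched] by blast
qed

text \<open>The spectrum of X = I + sT lies within |s| K \<le> 1/4 of 1. The upper bound is the
  tangent line and has no error term; f(3/4) is a positive lower bound that does not depend on
  \<open>s\<close>.\<close>

lemma fun_calc_perturbation:
  fixes T :: "'a::chilbert_space \<Rightarrow> 'a"
  assumes T: "T \<in> self_adjoint_ops univ_hspace"
    and K: "\<And>x. \<bar>inner (T x) x\<bar> \<le> K * (norm x)\<^sup>2" and s: "\<bar>s\<bar> * K \<le> 1 / 4"
    and \<alpha>: "0 \<le> C" "\<And>x. x > 0 \<Longrightarrow> f x \<le> 1 + \<alpha> * (x - 1)"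
      "\<And>x. \<bar>x - 1\<bar> \<le> 1 / 4 \<Longrightarrow> 1 + \<alpha> * (x - 1) - C * (x - 1)\<^sup>2 \<le> f x"
    and f: "continuous_on {0<..} f" "\<And>x y. 0 < x \<Longrightarrow> x \<le> y \<Longrightarrow> f x \<le> f y"
  defines "X \<equiv> (\<lambda>x. s *\<^sub>R T x + x)"
  shows "spectrum_in univ_hspace X {0<..}"
    and "fun_calc univ_hspace f X \<in> self_adjoint_ops univ_hspace"
    and "f (3 / 4) * (norm x)\<^sup>2 \<le> inner (fun_calc univ_hspace f X x) x"
    and "inner (fun_calc univ_hspace f X x) x \<le> (norm x)\<^sup>2 + \<alpha> * s * inner (T x) x"
    and "(norm x)\<^sup>2 + \<alpha> * s * inner (T x) x - C * (s * K)\<^sup>2 * (norm x)\<^sup>2 \<le>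
      inner (fun_calc univ_hspace f X x) x"
proof -
  have X: "X \<in> self_adjoint_ops univ_hspace"
    using self_adjoint_affine[OF T, of 1 s] by (simp add: X_def add.commute)
  have form: "inner (X x) x = (norm x)\<^sup>2 + s * inner (T x) x" for x
    by (simp add: X_def inner_add_left power2_norm_eq_inner)
  have sT: "\<bar>s * inner (T x) x\<bar> \<le> \<bar>s\<bar> * K * (norm x)\<^sup>2" for x
    using mult_left_mono[OF K[of x], of "\<bar>s\<bar>"] by (simp add: abs_mult mult.assoc)
  have quarter: "\<bar>s\<bar> * K * (norm x)\<^sup>2 \<le> 1 / 4 * (norm x)\<^sup>2" for x :: 'a
    using s by (intro mult_right_mono) auto
  have lower: "3 / 4 * (norm x)\<^sup>2 \<le> inner (X x) x" for x
    using sT[of x] quarter[of x] unfolding form by linarith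
  show "spectrum_in univ_hspace X {0<..}"
    using lower by (intro spectrum_in_positiveI[OF X, of "3 / 4"]) auto
  have "real_spectrum univ_hspace X \<subseteq> {1 - \<bar>s\<bar> * K..1 + \<bar>s\<bar> * K}"
  proof (rule real_spectrum_bounds[OF X])
    fix x
    show "(1 - \<bar>s\<bar> * K) * (norm x)\<^sup>2 \<le> inner (X x) x" "inner (X x) x \<le> (1 + \<bar>s\<bar> * K) * (norm x)\<^sup>2"
      using sT[of x] unfolding form left_diff_distrib distrib_right by linarith+
  qed
  then have spec: "\<bar>t - 1\<bar> \<le> \<bar>s\<bar> * K" "3 / 4 \<le> t" if "t \<in> real_spectrum univ_hspace X" for t
    using that s by fastforce+
  have cont: "continuous_on (real_spectrum univ_hspace X) f"
    using spec(2) by (intro continuous_on_subset[OF f(1)]) fastforce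
  show "fun_calc univ_hspace f X \<in> self_adjoint_ops univ_hspace"
    by (rule fun_calc_self_adjoint[OF X cont])
  have "f (3 / 4) + 0 * t \<le> f t" if "t \<in> real_spectrum univ_hspace X" for t
    using spec(2)[OF that] f(2)[of "3 / 4" t] by simp
  from fun_calc_ge_affine[OF X cont this, of x]
  show "f (3 / 4) * (norm x)\<^sup>2 \<le> inner (fun_calc univ_hspace f X x) x"
    by simp
  have "f t \<le> (1 - \<alpha>) + \<alpha> * t" if "t \<in> real_spectrum univ_hspace X" for t
    using spec(2)[OF that] \<alpha>(2)[of t] by (simp add: algebra_simps)
  from fun_calc_le_affine[OF X cont this, of x]
  show "inner (fun_calc univ_hspace f X x) x \<le> (norm x)\<^sup>2 + \<alpha> * s * inner (T x) x"
    by (simp add: form algebra_simps)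
  \<comment> \<open>The quadratic error is replaced by its bound on the spectrum, which leaves an
    affine minorant.\<close>
  have "(1 - \<alpha> - C * (s * K)\<^sup>2) + \<alpha> * t \<le> f t" if "t \<in> real_spectrum univ_hspace X" for t
  proof -
    have "\<bar>t - 1\<bar> \<le> 1 / 4"
      using spec(1)[OF that] s by linarith
    moreover have "(t - 1)\<^sup>2 \<le> (s * K)\<^sup>2"
      using power_mono[OF spec(1)[OF that], of 2] by (simp add: power_mult_distrib)
    then have "C * (t - 1)\<^sup>2 \<le> C * (s * K)\<^sup>2"
      using \<alpha>(1) by (rule mult_left_mono)
    ultimately show ?thesis
      using \<alpha>(3)[of t] by (simp add: algebra_simps)
  qed
  from fun_calc_ge_affine[OF X cont this, of x]
  show "(norm x)\<^sup>2 + \<alpha> * s * inner (T x) x - C * (s * K)\<^sup>2 * (norm x)\<^sup>2 \<le>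
      inner (fun_calc univ_hspace f X x) x"
    by (simp add: form algebra_simps)
qed

text \<open>R = P^(1/2) and Z = P^(-1/2) Q P^(-1/2). At y = Rx the forms of I and \<open>Z\<close>
  are those of \<open>P\<close> and \<open>Q\<close> at \<open>x\<close>, and \<open>R\<close> is
  onto, so bounds of \<open>Q\<close> relative to \<open>P\<close> are bounds for
  \<open>Z\<close>.\<close>

lemma op_mean_decomposition:
  fixes P Q :: "'a::chilbert_space \<Rightarrow> 'a"
  assumes P: "P \<in> self_adjoint_ops univ_hspace" and Q: "Q \<in> self_adjoint_ops univ_hspace"
    and m: "m > 0" "\<And>x. m * (norm x)\<^sup>2 \<le> inner (P x) x" "\<And>x. m * (norm x)\<^sup>2 \<le> inner (Q x) x"
    and \<Phi>: "continuous_on {0<..} \<Phi>"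
  obtains R Z where "R \<in> self_adjoint_ops univ_hspace" "Z \<in> self_adjoint_ops univ_hspace" "surj R"
    "real_spectrum univ_hspace Z \<subseteq> {0<..}"
    "op_mean univ_hspace \<Phi> P Q = (\<lambda>x. R (fun_calc univ_hspace \<Phi> Z (R x)))"
    "op_mean univ_hspace \<Phi> P Q \<in> self_adjoint_ops univ_hspace"
    "\<And>x. (norm (R x))\<^sup>2 = inner (P x) x" "\<And>x. inner (Z (R x)) (R x) = inner (Q x) x"
proof -
  obtain K where K: "K > 0" "\<And>x. \<bar>inner (P x) x\<bar> \<le> K * (norm x)\<^sup>2"
    using self_adjoint_form_bound[OF P] by blast
  have PK: "inner (P x) x \<le> K * (norm x)\<^sup>2" for x
    using K(2)[of x] by linarith
  obtain L where L: "\<And>x. \<bar>inner (Q x) x\<bar> \<le> L * (norm x)\<^sup>2" "L > 0"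
    using self_adjoint_form_bound[OF Q] by blast
  have QL: "inner (Q x) x \<le> L * (norm x)\<^sup>2" for x
    using L(1)[of x] by linarith
  have spec: "t > 0" if "t \<in> real_spectrum univ_hspace P" for t
    using real_spectrum_bounds[OF P m(2) PK] that m(1) by fastforce
  define R where "R = fun_calc univ_hspace sqrt P"
  define R' where "R' = fun_calc univ_hspace (\<lambda>t. 1 / sqrt t) P"
  have c: "continuous_on (real_spectrum univ_hspace P) sqrt"
    "continuous_on (real_spectrum univ_hspace P) (\<lambda>t. 1 / sqrt t)"
    using spec by (force intro!: continuous_intros)+
  have R: "R \<in> self_adjoint_ops univ_hspace" and R': "R' \<in> self_adjoint_ops univ_hspace"
    unfolding R_def R'_def by (intro fun_calc_self_adjoint[OF P] c)+
  have eq_affine: "fun_calc univ_hspace g P x = a *\<^sub>R x + b *\<^sub>R P x"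
    if "\<And>t. t > 0 \<Longrightarrow> g t = a + b * t" for g a b x
    using fun_calc_cong[of univ_hspace P g "\<lambda>t. a + b * t"] spec that
    by (simp add: fun_calc_affine[OF P])
  have RR: "R (R x) = P x" for x
    unfolding R_def fun_calc_mult[OF P c(1) c(1), symmetric] by (subst eq_affine[of _ 0 1]) auto
  have RR': "R (R' x) = x" for x
    unfolding R_def R'_def fun_calc_mult[OF P c(1) c(2), symmetric]
    by (subst eq_affine[of _ 1 0]) auto
  have R'R: "R' (R x) = x" for x
    unfolding R_def R'_def fun_calc_mult[OF P c(2) c(1), symmetric]
    by (subst eq_affine[of _ 1 0]) auto
  have normR: "(norm (R x))\<^sup>2 = inner (P x) x" for x
    using self_adjointD(3)[OF R, of "R x" x] by (simp add: RR power2_norm_eq_inner)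
  define Z where "Z = (\<lambda>x. R' (Q (R' x)))"
  have Z: "Z \<in> self_adjoint_ops univ_hspace"
  proof (rule self_adjointI)
    show "bounded_linear Z"
      unfolding Z_def
      by (intro bounded_linear_compose[OF self_adjointD(1)[OF R']]
          bounded_linear_compose[OF self_adjointD(1)[OF Q]] self_adjointD(1)[OF R'])
    show "Z (c *\<^sub>C x) = c *\<^sub>C Z x" for c x
      by (simp only: Z_def self_adjointD(2)[OF R'] self_adjointD(2)[OF Q])
    show "inner (Z x) y = inner x (Z y)" for x y
      by (simp only: Z_def self_adjointD(3)[OF R'] self_adjointD(3)[OF Q])
  qed
  have ZR: "inner (Z (R x)) (R x) = inner (Q x) x" for x
    using self_adjointD(3)[OF R', of "Q x" "R x"] by (simp add: Z_def R'R)
  \<comment> \<open>From Q \<ge> m \<ge> (m/K) P and Q \<le> L \<le> (L/m) P.\<close>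
  have "m / K * (norm y)\<^sup>2 \<le> inner (Z y) y" "inner (Z y) y \<le> L / m * (norm y)\<^sup>2" for y
  proof -
    have y: "(norm y)\<^sup>2 = inner (P (R' y)) (R' y)" "inner (Z y) y = inner (Q (R' y)) (R' y)"
      using normR[of "R' y"] ZR[of "R' y"] by (simp_all add: RR')
    have "m / K * (norm y)\<^sup>2 \<le> m / K * (K * (norm (R' y))\<^sup>2)"
      unfolding y using m(1) K(1) PK by (intro mult_left_mono) auto
    also have "\<dots> \<le> inner (Z y) y"
      unfolding y using K(1) m(3)[of "R' y"] by simp
    finally show "m / K * (norm y)\<^sup>2 \<le> inner (Z y) y" .
    have "inner (Z y) y \<le> L / m * (m * (norm (R' y))\<^sup>2)"
      unfolding y using m(1) QL[of "R' y"] by simp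
    also have "\<dots> \<le> L / m * (norm y)\<^sup>2"
      unfolding y using m(1,2) L(2) by (intro mult_left_mono) auto
    finally show "inner (Z y) y \<le> L / m * (norm y)\<^sup>2" .
  qed
  then have "real_spectrum univ_hspace Z \<subseteq> {m / K..L / m}"
    by (intro real_spectrum_bounds[OF Z])
  moreover have "m / K > 0"
    using m K by simp
  ultimately have specZ: "real_spectrum univ_hspace Z \<subseteq> {0<..}"
    by fastforce
  have mean: "op_mean univ_hspace \<Phi> P Q = (\<lambda>x. R (fun_calc univ_hspace \<Phi> Z (R x)))"
    by (simp add: op_mean_def Let_def Z_def R_def R'_def)
  have W: "fun_calc univ_hspace \<Phi> Z \<in> self_adjoint_ops univ_hspace"
    by (rule fun_calc_self_adjoint[OF Z continuous_on_subset[OF \<Phi> specZ]])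
  have "(\<lambda>x. R (fun_calc univ_hspace \<Phi> Z (R x))) \<in> self_adjoint_ops univ_hspace"
  proof (rule self_adjointI)
    show "bounded_linear (\<lambda>x. R (fun_calc univ_hspace \<Phi> Z (R x)))"
      by (intro bounded_linear_compose[OF self_adjointD(1)[OF R]]
          bounded_linear_compose[OF self_adjointD(1)[OF W]] self_adjointD(1)[OF R])
  qed (simp_all only: self_adjointD(2,3)[OF R] self_adjointD(2,3)[OF W])
  moreover have "surj R"
    by (rule surjI[of R R']) (rule RR')
  ultimately show thesis
    using that[OF R Z _ specZ mean _ normR ZR] mean by simp
qed

text \<open>\<Phi> lies below its tangent line (1 - w) + w t. Evaluated at \<open>Z\<close> and
  taken between two factors \<open>R\<close>, the line becomes the weighted arithmetic mean (1 - w)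
  P + w Q.\<close>

lemma op_mean_le_arithmetic:
  fixes P Q :: "'a::chilbert_space \<Rightarrow> 'a"
  assumes P: "P \<in> self_adjoint_ops univ_hspace" and Q: "Q \<in> self_adjoint_ops univ_hspace"
    and m: "m > 0" "\<And>x. m * (norm x)\<^sup>2 \<le> inner (P x) x" "\<And>x. m * (norm x)\<^sup>2 \<le> inner (Q x) x"
    and \<Phi>: "continuous_on {0<..} \<Phi>" "\<And>x. x > 0 \<Longrightarrow> \<Phi> x \<le> 1 + w * (x - 1)"
  shows "inner (op_mean univ_hspace \<Phi> P Q x) x \<le> (1 - w) * inner (P x) x + w * inner (Q x) x"
    and "op_mean univ_hspace \<Phi> P Q \<in> self_adjoint_ops univ_hspace"
proof -
  obtain R Z where R: "R \<in> self_adjoint_ops univ_hspace" and Z: "Z \<in> self_adjoint_ops univ_hspace"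
    and surj: "surj R" and spec: "real_spectrum univ_hspace Z \<subseteq> {0<..}"
    and mean: "op_mean univ_hspace \<Phi> P Q = (\<lambda>x. R (fun_calc univ_hspace \<Phi> Z (R x)))"
    and mean_sa: "op_mean univ_hspace \<Phi> P Q \<in> self_adjoint_ops univ_hspace"
    and RP: "\<And>x. (norm (R x))\<^sup>2 = inner (P x) x"
    and ZR: "\<And>x. inner (Z (R x)) (R x) = inner (Q x) x"
    by (rule op_mean_decomposition[OF P Q m \<Phi>(1)]) (rule that)
  show "op_mean univ_hspace \<Phi> P Q \<in> self_adjoint_ops univ_hspace"
    by (rule mean_sa)
  have "\<Phi> t \<le> (1 - w) + w * t" if "t \<in> real_spectrum univ_hspace Z" for t
    using \<Phi>(2)[of t] spec that by (auto simp: algebra_simps)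
  from fun_calc_le_affine[OF Z continuous_on_subset[OF \<Phi>(1) spec] this, of "R x"]
  show "inner (op_mean univ_hspace \<Phi> P Q x) x \<le> (1 - w) * inner (P x) x + w * inner (Q x) x"
    by (simp add: mean self_adjointD(3)[OF R] RP ZR)
qed

text \<open>If \<open>P\<close> and \<open>Q\<close> differ by at most \<eta> m, hence by at most
  \<eta> P, the spectrum of \<open>Z\<close> lies within \<eta> of 1. There \<Phi> falls short of
  its tangent line by at most C \<eta>^2, which costs C \<eta>^2 P.\<close>

lemma op_mean_ge_arithmetic:
  fixes P Q :: "'a::chilbert_space \<Rightarrow> 'a"
  assumes P: "P \<in> self_adjoint_ops univ_hspace" and Q: "Q \<in> self_adjoint_ops univ_hspace"
    and m: "m > 0" "\<And>x. m * (norm x)\<^sup>2 \<le> inner (P x) x" "\<And>x. m * (norm x)\<^sup>2 \<le> inner (Q x) x"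
    and \<Phi>: "continuous_on {0<..} \<Phi>"
      "\<And>x. \<bar>x - 1\<bar> \<le> 1 / 4 \<Longrightarrow> 1 + w * (x - 1) - C * (x - 1)\<^sup>2 \<le> \<Phi> x" "0 \<le> C"
    and \<eta>: "\<eta> \<le> 1 / 4" "\<And>x. \<bar>inner (Q x) x - inner (P x) x\<bar> \<le> \<eta> * m * (norm x)\<^sup>2" "0 \<le> \<eta>"
  shows "(1 - w - C * \<eta>\<^sup>2) * inner (P x) x + w * inner (Q x) x \<le> inner (op_mean univ_hspace \<Phi> P Q x) x"
proof -
  obtain R Z where R: "R \<in> self_adjoint_ops univ_hspace" and Z: "Z \<in> self_adjoint_ops univ_hspace"
    and surj: "surj R" and spec: "real_spectrum univ_hspace Z \<subseteq> {0<..}"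
    and mean: "op_mean univ_hspace \<Phi> P Q = (\<lambda>x. R (fun_calc univ_hspace \<Phi> Z (R x)))"
    and mean_sa: "op_mean univ_hspace \<Phi> P Q \<in> self_adjoint_ops univ_hspace"
    and RP: "\<And>x. (norm (R x))\<^sup>2 = inner (P x) x"
    and ZR: "\<And>x. inner (Z (R x)) (R x) = inner (Q x) x"
    by (rule op_mean_decomposition[OF P Q m \<Phi>(1)]) (rule that)
  have Z1: "\<bar>inner (Z y) y - (norm y)\<^sup>2\<bar> \<le> \<eta> * (norm y)\<^sup>2" for y
  proof -
    obtain x where x: "y = R x"
      using surj by (metis surjD)
    have "\<eta> * (m * (norm x)\<^sup>2) \<le> \<eta> * inner (P x) x"
      using m(2) \<eta>(3) by (intro mult_left_mono)
    then show ?thesis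
      using \<eta>(2)[of x] by (simp add: x RP ZR mult.assoc)
  qed
  have "real_spectrum univ_hspace Z \<subseteq> {1 - \<eta>..1 + \<eta>}"
  proof (rule real_spectrum_bounds[OF Z])
    fix y
    show "(1 - \<eta>) * (norm y)\<^sup>2 \<le> inner (Z y) y" "inner (Z y) y \<le> (1 + \<eta>) * (norm y)\<^sup>2"
      using Z1[of y] unfolding left_diff_distrib distrib_right by linarith+
  qed
  then have near: "\<bar>t - 1\<bar> \<le> \<eta>" if "t \<in> real_spectrum univ_hspace Z" for t
    using that by fastforce
  have "(1 - w - C * \<eta>\<^sup>2) + w * t \<le> \<Phi> t" if "t \<in> real_spectrum univ_hspace Z" for t
  proof -
    have "(t - 1)\<^sup>2 \<le> \<eta>\<^sup>2"
      using power_mono[OF near[OF that], of 2] by simp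
    then have "C * (t - 1)\<^sup>2 \<le> C * \<eta>\<^sup>2"
      using \<Phi>(3) by (rule mult_left_mono)
    then show ?thesis
      using \<Phi>(2)[of t] near[OF that] \<eta>(1) by (simp add: algebra_simps)
  qed
  from fun_calc_ge_affine[OF Z continuous_on_subset[OF \<Phi>(1) spec] this, of "R x"]
  show ?thesis
    by (simp add: mean self_adjointD(3)[OF R] RP ZR)
qed


theorem theorem1:
  fixes H :: "'h::chilbert_space hspace"
    and \<Phi> f :: "real \<Rightarrow> real" and w :: real and A B :: "'h \<Rightarrow> 'h"
  assumes H: "H = univ_hspace"
    and nonzero: "hcarrier H \<noteq> {hzero H}"
    and \<Phi>: "\<Phi> \<in> OM1 TYPE('h)" "\<not> \<Phi> constant_on {0<..}"
    and f: "f \<in> OM1 TYPE('h)" "\<not> f constant_on {0<..}"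
    and w: "(\<Phi> has_real_derivative w) (at 1)" "0 < w" "w < 1"
    and A: "A \<in> self_adjoint_ops H"
    and B: "B \<in> self_adjoint_ops H"
  shows "op_le H (op_scale H (of_real (1 - w)) A) (op_scale H (of_real w) B) \<longleftrightarrow>
    (\<exists>s\<^sub>0>0. \<forall>s\<in>{0..s\<^sub>0::real}.
      (let X = op_add H (op_scale H (of_real s) A) (op_id H);
           Y = op_add H (op_scale H (of_real (- s)) B) (op_id H)
       in spectrum_in H X {0<..} \<and> spectrum_in H Y {0<..} \<and>
          op_le H (op_mean H \<Phi> (fun_calc H f X) (fun_calc H f Y)) (op_id H)))"
proof -
  obtain v :: 'h where v: "v \<noteq> 0"
    using nonzero by (auto simp: H)
  note A = A[unfolded H] and B = B[unfolded H]
  obtain \<alpha> C where f': "0 \<le> \<alpha>" "0 \<le> C" "\<And>x. x > 0 \<Longrightarrow> f x \<le> 1 + \<alpha> * (x - 1)"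
    "\<And>x. \<bar>x - 1\<bar> \<le> 1 / 4 \<Longrightarrow> 1 + \<alpha> * (x - 1) - C * (x - 1)\<^sup>2 \<le> f x"
    "(f has_real_derivative \<alpha>) (at 1)" "continuous_on {0<..} f"
    "\<And>x y. 0 < x \<Longrightarrow> x \<le> y \<Longrightarrow> f x \<le> f y" "\<not> f constant_on {0<..} \<Longrightarrow> 0 < \<alpha>"
    by (rule OM1_expansion[OF f(1) v]) (rule that)
  obtain w' D where \<Phi>': "0 \<le> w'" "0 \<le> D" "\<And>x. x > 0 \<Longrightarrow> \<Phi> x \<le> 1 + w' * (x - 1)"
    "\<And>x. \<bar>x - 1\<bar> \<le> 1 / 4 \<Longrightarrow> 1 + w' * (x - 1) - D * (x - 1)\<^sup>2 \<le> \<Phi> x"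
    "(\<Phi> has_real_derivative w') (at 1)" "continuous_on {0<..} \<Phi>"
    "\<And>x y. 0 < x \<Longrightarrow> x \<le> y \<Longrightarrow> \<Phi> x \<le> \<Phi> y" "\<not> \<Phi> constant_on {0<..} \<Longrightarrow> 0 < w'"
    by (rule OM1_expansion[OF \<Phi>(1) v]) (rule that)
  have w': "w' = w"
    by (rule DERIV_unique[OF \<Phi>'(5) w(1)])
  note \<Phi>' = \<Phi>'[unfolded w']
  obtain KA where KA: "KA > 0" "\<And>x. \<bar>inner (A x) x\<bar> \<le> KA * (norm x)\<^sup>2"
    using self_adjoint_form_bound[OF A] by blast
  obtain KB where KB: "KB > 0" "\<And>x. \<bar>inner (B x) x\<bar> \<le> KB * (norm x)\<^sup>2"
    using self_adjoint_form_bound[OF B] by blast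
  define K where "K = max KA KB"
  have K: "K > 0" "\<bar>inner (A x) x\<bar> \<le> K * (norm x)\<^sup>2" "\<bar>inner (B x) x\<bar> \<le> K * (norm x)\<^sup>2" for x
    using KA(1) order.trans[OF KA(2)[of x] mult_right_mono[of KA K]]
      order.trans[OF KB(2)[of x] mult_right_mono[of KB K]] by (auto simp: K_def)
  define m where "m = f (3 / 4)"
  have m: "m > 0"
    using f(1) by (simp add: m_def OM1_def)
  define P where "P s = fun_calc univ_hspace f (\<lambda>x. s *\<^sub>R A x + x)" for s
  define Q where "Q s = fun_calc univ_hspace f (\<lambda>x. (- s) *\<^sub>R B x + x)" for s
  have small: "\<bar>s\<bar> * K \<le> 1 / 4" if "s \<in> {0..1 / (4 * K)}" for s
    using that K(1) by (simp add: field_simps)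
  \<comment> \<open>Facts 1 to 5 concern \<open>P s\<close>; facts 6 to 10 concern
    \<open>Q s\<close> and come from the same lemma with -s in place of s.\<close>
  note PQ = fun_calc_perturbation[OF A K(2) _ f'(2,3,4,6,7), folded P_def m_def]
    fun_calc_perturbation[OF B K(3) _ f'(2,3,4,6,7), of "- s" for s, unfolded abs_minus_cancel, folded Q_def m_def]
  have I: "(\<lambda>x::'h. x) \<in> self_adjoint_ops univ_hspace"
    by (rule self_adjointI) simp_all
  let ?D = "\<lambda>x. (1 - w) * inner (A x) x - w * inner (B x) x"
  have lhs: "op_le H (op_scale H (of_real (1 - w)) A) (op_scale H (of_real w) B) \<longleftrightarrow> (\<forall>x. ?D x \<le> 0)"
    using op_le_iff[OF self_adjoint_affine[OF A, of 0 "1 - w"] self_adjoint_affine[OF B, of 0 w]]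
    by (simp add: H del: of_real_diff)
  have mean_sa: "op_mean univ_hspace \<Phi> (P s) (Q s) \<in> self_adjoint_ops univ_hspace"
    and mean_le: "inner (op_mean univ_hspace \<Phi> (P s) (Q s) x) x \<le> (norm x)\<^sup>2 + \<alpha> * s * ?D x"
    if s: "s \<in> {0..1 / (4 * K)}" for s x
  proof -
    note PQs = PQ[OF small[OF s]]
    note le = op_mean_le_arithmetic[OF PQs(2,7) m PQs(3,8) \<Phi>'(6,3)]
    show "op_mean univ_hspace \<Phi> (P s) (Q s) \<in> self_adjoint_ops univ_hspace"
      by (rule le(2))
    have "(1 - w) * inner (P s x) x + w * inner (Q s x) x \<le>
        (1 - w) * ((norm x)\<^sup>2 + \<alpha> * s * inner (A x) x) + w * ((norm x)\<^sup>2 + \<alpha> * (- s) * inner (B x) x)"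
      using PQs(4,9) w by (intro add_mono mult_left_mono) auto
    also have "\<dots> = (norm x)\<^sup>2 + \<alpha> * s * ?D x"
      by (simp add: algebra_simps)
    finally show "inner (op_mean univ_hspace \<Phi> (P s) (Q s) x) x \<le> (norm x)\<^sup>2 + \<alpha> * s * ?D x"
      using le(1)[of x] by linarith
  qed
  have rhs: "(let X = op_add H (op_scale H (of_real s) A) (op_id H);
           Y = op_add H (op_scale H (of_real (- s)) B) (op_id H)
       in spectrum_in H X {0<..} \<and> spectrum_in H Y {0<..} \<and>
          op_le H (op_mean H \<Phi> (fun_calc H f X) (fun_calc H f Y)) (op_id H)) \<longleftrightarrow>
      (\<forall>x. inner (op_mean univ_hspace \<Phi> (P s) (Q s) x) x \<le> (norm x)\<^sup>2)"
    if s: "s \<in> {0..1 / (4 * K)}" for s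
  proof -
    have "(- complex_of_real s) *\<^sub>C y = - (s *\<^sub>R y)" for y :: 'h
      using scaleC_of_real[of "- s" y] by simp
    then show ?thesis
      using PQ(1,6)[OF small[OF s]] op_le_iff[OF mean_sa[OF s] I]
      by (simp add: H Let_def P_def Q_def power2_norm_eq_inner)
  qed
  show ?thesis
    unfolding lhs
  proof
    assume neg: "\<forall>x. ?D x \<le> 0"
    have "inner (op_mean univ_hspace \<Phi> (P s) (Q s) x) x \<le> (norm x)\<^sup>2"
      if s: "s \<in> {0..1 / (4 * K)}" for s x
    proof -
      have "\<alpha> * s * ?D x \<le> 0"
        using neg f'(1) s by (intro mult_nonneg_nonpos) auto
      then show ?thesis
        using mean_le[OF s, of x] by linarith
    qed
    then show "\<exists>s\<^sub>0>0. \<forall>s\<in>{0..s\<^sub>0::real}.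
      (let X = op_add H (op_scale H (of_real s) A) (op_id H);
           Y = op_add H (op_scale H (of_real (- s)) B) (op_id H)
       in spectrum_in H X {0<..} \<and> spectrum_in H Y {0<..} \<and>
          op_le H (op_mean H \<Phi> (fun_calc H f X) (fun_calc H f Y)) (op_id H))"
      using K(1) rhs by (intro exI[of _ "1 / (4 * K)"]) (simp only: zero_less_divide_iff, simp)
  next
    assume "\<exists>s\<^sub>0>0. \<forall>s\<in>{0..s\<^sub>0::real}.
      (let X = op_add H (op_scale H (of_real s) A) (op_id H);
           Y = op_add H (op_scale H (of_real (- s)) B) (op_id H)
       in spectrum_in H X {0<..} \<and> spectrum_in H Y {0<..} \<and>
          op_le H (op_mean H \<Phi> (fun_calc H f X) (fun_calc H f Y)) (op_id H))"
    then obtain s0 where s0: "s0 > 0" and le_I: "\<And>s x. s \<in> {0..s0} \<Longrightarrow> s \<in> {0..1 / (4 * K)} \<Longrightarrow>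
        inner (op_mean univ_hspace \<Phi> (P s) (Q s) x) x \<le> (norm x)\<^sup>2"
      using rhs by blast
    \<comment> \<open>The forms of \<open>P s\<close> and \<open>Q s\<close> differ by at most 2
      \<alpha> s K + C (sK)^2 per unit of |y|^2, and (sK)^2 \<le> sK. Division by \<open>m\<close>
      makes sL the parameter \<eta> of the lower estimate for the mean.\<close>
    define L where "L = (2 * \<alpha> * K + C * K) / m"
    have L: "L \<ge> 0"
      using f'(1,2) K(1) m by (simp add: L_def)
    \<comment> \<open>The last term ensures sL \<le> 1/4; the 1 in its denominator keeps it positive
      should \<open>L\<close> be 0.\<close>
    define s1 where "s1 = min (min s0 (1 / (4 * K))) (1 / (4 * L + 1))"
    have s1: "s1 > 0"
      using s0 K(1) L by (simp add: s1_def)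
    \<comment> \<open>C K^2 collects the errors of f(X) and f(Y), whose weights 1 - w and w add up
      to 1. D L^2 (1 + \<alpha>) is the error of \<Phi>, with <Px, x> \<le> (1 + \<alpha>)
      |x|^2.\<close>
    define E where "E = C * K\<^sup>2 + D * L\<^sup>2 * (1 + \<alpha>)"
    have E: "E \<ge> 0"
      using f'(1,2) \<Phi>'(2) by (simp add: E_def)
    have key: "\<alpha> * ?D x \<le> s * (E * (norm x)\<^sup>2)" if s: "0 < s" "s \<le> s1" for s x
    proof -
      have sK: "s \<in> {0..1 / (4 * K)}" and ss0: "s \<in> {0..s0}" and "s \<le> 1 / (4 * L + 1)"
        using s by (auto simp: s1_def)
      then have sL: "s * L \<le> 1 / 4"
        using L s by (simp add: field_simps)
      have K4: "s * K \<le> 1 / 4"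
        using small[OF sK] s by simp
      note PQs = PQ[OF small[OF sK]]
      have corr: "C * (s * K)\<^sup>2 * (norm y)\<^sup>2 \<le> C * K * s * (norm y)\<^sup>2" for y :: 'h
      proof -
        have "s * K * (s * K) \<le> s * K * 1"
          using K4 s K(1) by (intro mult_left_mono) auto
        then have "C * (s * K)\<^sup>2 \<le> C * (K * s)"
          using f'(2) by (intro mult_left_mono) (auto simp: power2_eq_square mult.commute)
        then show ?thesis
          by (intro mult_right_mono) (auto simp: mult.assoc)
      qed
      have forms: "\<bar>\<alpha> * s * inner (A y) y\<bar> \<le> \<alpha> * s * (K * (norm y)\<^sup>2)"
        "\<bar>\<alpha> * s * inner (B y) y\<bar> \<le> \<alpha> * s * (K * (norm y)\<^sup>2)" for y
        using K(2,3)[of y] f'(1) s by (simp_all add: abs_mult mult_left_mono)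
      have "\<bar>inner (Q s y) y - inner (P s y) y\<bar> \<le> s * L * m * (norm y)\<^sup>2" for y
      proof -
        have "s * L * m * (norm y)\<^sup>2 = 2 * (\<alpha> * s * (K * (norm y)\<^sup>2)) + C * K * s * (norm y)\<^sup>2"
        proof -
          have "L * m = 2 * \<alpha> * K + C * K"
            using m by (simp add: L_def)
          then have "s * L * m * (norm y)\<^sup>2 = s * (2 * \<alpha> * K + C * K) * (norm y)\<^sup>2"
            by (simp only: mult.assoc[of s])
          then show ?thesis
            by (simp add: algebra_simps)
        qed
        moreover have "0 \<le> C * (- s * K)\<^sup>2 * (norm y)\<^sup>2"
          using f'(2) by simp
        ultimately show ?thesis
          using PQs(4,5,9,10)[of y] forms[of y] corr[of y] by (simp add: abs_le_iff)
      qed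
      from op_mean_ge_arithmetic[OF PQs(2,7) m PQs(3,8) \<Phi>'(6,4,2) sL this, of x] L s
      have "(1 - w - D * (s * L)\<^sup>2) * inner (P s x) x + w * inner (Q s x) x \<le> (norm x)\<^sup>2"
        using le_I[OF ss0 sK, of x] by simp
      moreover have "(1 - w) * ((norm x)\<^sup>2 + \<alpha> * s * inner (A x) x - C * (s * K)\<^sup>2 * (norm x)\<^sup>2)
          \<le> (1 - w) * inner (P s x) x"
        using PQs(5) w by (intro mult_left_mono) auto
      moreover have "w * ((norm x)\<^sup>2 - \<alpha> * s * inner (B x) x - C * (s * K)\<^sup>2 * (norm x)\<^sup>2)
          \<le> w * inner (Q s x) x"
        using PQs(10)[of x] w by (intro mult_left_mono) auto
      moreover have "inner (P s x) x \<le> (1 + \<alpha>) * (norm x)\<^sup>2"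
      proof -
        have "\<alpha> * (s * K) * (norm x)\<^sup>2 \<le> \<alpha> * 1 * (norm x)\<^sup>2"
          using K4 f'(1) by (intro mult_right_mono mult_left_mono) auto
        then show ?thesis
          using PQs(4)[of x] forms(1)[of x] by (simp add: algebra_simps)
      qed
      then have "D * (s * L)\<^sup>2 * inner (P s x) x \<le> D * (s * L)\<^sup>2 * ((1 + \<alpha>) * (norm x)\<^sup>2)"
        using \<Phi>'(2) by (intro mult_left_mono) auto
      ultimately have "s * (\<alpha> * ?D x) \<le> C * (s * K)\<^sup>2 * (norm x)\<^sup>2
          + D * (s * L)\<^sup>2 * ((1 + \<alpha>) * (norm x)\<^sup>2)"
        by (simp add: algebra_simps)
      also have "\<dots> = s * (s * (E * (norm x)\<^sup>2))"
        by (simp add: E_def power_mult_distrib power2_eq_square[of s] algebra_simps)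
      finally show ?thesis
        using s by simp
    qed
    show "\<forall>x. ?D x \<le> 0"
    proof
      fix x
      have "\<alpha> * ?D x \<le> 0"
      proof (rule tendsto_lowerbound)
        show "((\<lambda>s. s * (E * (norm x)\<^sup>2)) \<longlongrightarrow> 0) (at_right 0)"
          by (auto intro!: tendsto_eq_intros)
        show "\<forall>\<^sub>F s in at_right 0. \<alpha> * ?D x \<le> s * (E * (norm x)\<^sup>2)"
          unfolding eventually_at_right_field using s1 key by (intro exI[of _ s1]) auto
      qed simp
      then show "?D x \<le> 0"
        \<comment> \<open>Nonconstancy of \<open>f\<close> makes \<alpha> positive, so it can be
          cancelled.\<close>
        using f'(8)[OF f(2)] by (simp add: mult_le_0_iff)
    qed
  qed
qed

end
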